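(* Let $F$ be a field of characteristic $2$ and let $A$ be a biquaternion algebra over $F$ (a tensor product of two quaternion algebras over $F$). Then the graph $G_A$ has diameter at most $3$. More precisely, any two vertices of $G_A$ are joined by a path of length at most $3$ consisting of at most two edges of type I and at most one edge of type II, and if all three edges are needed, the type II edge lies between the two type I edges.
   Context: For $\alpha\in F$ and $\beta\in F^\times$, $[\alpha,\beta)$ denotes the quaternion algebra $F\langle i,j : i^2+i=\alpha,\ j^2=\beta,\ jij^{-1}=i+1\rangle$. The graph $G_A=(V,E)$ is defined as follows: $V$ is the set of ordered pairs $(Q_1,Q_2)$ of isomorphism classes of quaternion algebras over $F$ with $A\cong Q_1\otimes_F Q_2$. There is an (undirected) edge between $(Q_1,Q_2)$ and $(Q_3,Q_4)$ if there exist presentations $Q_1=[a,b)$, $Q_2=[c,d)$ (with $a,c\in F$, $b,d\in F^\times$) such that either $Q_3\cong[a+c,b)$ and $Q_4\cong[c,bd)$ (an edge of type I), or $Q_3\cong[a,b(a+c))$ and $Q_4\cong[c,d(a+c))$ (an edge of type II; here $a+c\neq 0$). The diameter of a graph is the supremum, over all pairs of vertices, of the length of a shortest path between them. *)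

theory Defs
  imports Main
begin

text \<open>A finite-dimensional algebra over a field 'a, given by its dimension n and its
structure constants: with basis e_0,...,e_(n-1), e_i * e_j = sum over k<n of sc i j k * e_k.\<close>
type_synonym 'a alg = "nat \<times> (nat \<Rightarrow> nat \<Rightarrow> nat \<Rightarrow> 'a)"

text \<open>Isomorphism of algebras: an invertible linear map (matrix M, inverse N; the image of
e_i is the sum over l of M i l * f_l) that is multiplicative on basis elements.\<close>
definition alg_iso :: "'a::field alg \<Rightarrow> 'a alg \<Rightarrow> bool" where
  "alg_iso A B \<longleftrightarrow> fst A = fst B \<and>
     (\<exists>M N :: nat \<Rightarrow> nat \<Rightarrow> 'a.
        (\<forall>i<fst A. \<forall>j<fst A. (\<Sum>k<fst A. M i k * N k j) = (if i = j then 1 else 0)) \<and>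
        (\<forall>i<fst A. \<forall>j<fst A. (\<Sum>k<fst A. N i k * M k j) = (if i = j then 1 else 0)) \<and>
        (\<forall>i<fst A. \<forall>j<fst A. \<forall>l<fst A.
            (\<Sum>k<fst A. snd A i j k * M k l)
          = (\<Sum>p<fst A. \<Sum>q<fst A. M i p * M j q * snd B p q l)))"

text \<open>Tensor product of algebras, basis e_i (x) f_j indexed by i*m + j.\<close>
definition alg_tensor :: "'a::field alg \<Rightarrow> 'a alg \<Rightarrow> 'a alg" where
  "alg_tensor A B = (fst A * fst B,
     (\<lambda>i j k. snd A (i div fst B) (j div fst B) (k div fst B)
              * snd B (i mod fst B) (j mod fst B) (k mod fst B)))"

definition vec4 :: "'a::field \<Rightarrow> 'a \<Rightarrow> 'a \<Rightarrow> 'a \<Rightarrow> nat \<Rightarrow> 'a" where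
  "vec4 w x y z k = (if k = 0 then w else if k = 1 then x else if k = 2 then y
                     else if k = 3 then z else 0)"

text \<open>The quaternion algebra [alpha,beta) in characteristic 2, basis 1, i, j, ij
(indices 0,1,2,3), with i^2 + i = alpha, j^2 = beta, j i = (i+1) j.\<close>
definition quat_prod :: "'a::field \<Rightarrow> 'a \<Rightarrow> nat \<Rightarrow> nat \<Rightarrow> nat \<Rightarrow> 'a" where
  "quat_prod \<alpha> \<beta> i j =
     (if i \<ge> 4 \<or> j \<ge> 4 then (\<lambda>_. 0)
      else if i = 0 then (\<lambda>k. if k = j then 1 else 0)
      else if j = 0 then (\<lambda>k. if k = i then 1 else 0)
      else if i = 1 \<and> j = 1 then vec4 \<alpha> 1 0 0
      else if i = 1 \<and> j = 2 then vec4 0 0 0 1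
      else if i = 1 \<and> j = 3 then vec4 0 0 \<alpha> 1
      else if i = 2 \<and> j = 1 then vec4 0 0 1 1
      else if i = 2 \<and> j = 2 then vec4 \<beta> 0 0 0
      else if i = 2 \<and> j = 3 then vec4 \<beta> \<beta> 0 0
      else if i = 3 \<and> j = 1 then vec4 0 0 \<alpha> 0
      else if i = 3 \<and> j = 2 then vec4 0 \<beta> 0 0
      else vec4 (\<alpha> * \<beta>) 0 0 0)"

definition quat :: "'a::field \<Rightarrow> 'a \<Rightarrow> 'a alg" where
  "quat \<alpha> \<beta> = (4, quat_prod \<alpha> \<beta>)"

definition is_quaternion :: "'a::field alg \<Rightarrow> bool" where
  "is_quaternion Q \<longleftrightarrow> (\<exists>a b. b \<noteq> 0 \<and> alg_iso Q (quat a b))"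

text \<open>Vertices of G_A: pairs (Q1,Q2) of quaternion algebras with A = Q1 (x) Q2,
considered up to isomorphism of each component (same_vertex).\<close>
definition is_vertex :: "'a::field alg \<Rightarrow> 'a alg \<times> 'a alg \<Rightarrow> bool" where
  "is_vertex A V \<longleftrightarrow> is_quaternion (fst V) \<and> is_quaternion (snd V)
      \<and> alg_iso A (alg_tensor (fst V) (snd V))"

definition same_vertex :: "'a::field alg \<times> 'a alg \<Rightarrow> 'a alg \<times> 'a alg \<Rightarrow> bool" where
  "same_vertex U V \<longleftrightarrow> alg_iso (fst U) (fst V) \<and> alg_iso (snd U) (snd V)"

definition edgeI_dir :: "'a::field alg \<times> 'a alg \<Rightarrow> 'a alg \<times> 'a alg \<Rightarrow> bool" where
  "edgeI_dir U V \<longleftrightarrow> (\<exists>a b c d. b \<noteq> 0 \<and> d \<noteq> 0 \<and>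
      alg_iso (fst U) (quat a b) \<and> alg_iso (snd U) (quat c d) \<and>
      alg_iso (fst V) (quat (a + c) b) \<and> alg_iso (snd V) (quat c (b * d)))"

definition edgeII_dir :: "'a::field alg \<times> 'a alg \<Rightarrow> 'a alg \<times> 'a alg \<Rightarrow> bool" where
  "edgeII_dir U V \<longleftrightarrow> (\<exists>a b c d. b \<noteq> 0 \<and> d \<noteq> 0 \<and> a + c \<noteq> 0 \<and>
      alg_iso (fst U) (quat a b) \<and> alg_iso (snd U) (quat c d) \<and>
      alg_iso (fst V) (quat a (b * (a + c))) \<and> alg_iso (snd V) (quat c (d * (a + c))))"

definition edgeI :: "'a::field alg \<times> 'a alg \<Rightarrow> 'a alg \<times> 'a alg \<Rightarrow> bool" where
  "edgeI U V \<longleftrightarrow> edgeI_dir U V \<or> edgeI_dir V U"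

definition edgeII :: "'a::field alg \<times> 'a alg \<Rightarrow> 'a alg \<times> 'a alg \<Rightarrow> bool" where
  "edgeII U V \<longleftrightarrow> edgeII_dir U V \<or> edgeII_dir V U"

end

theory Submission
  imports Defs Complex_Main "HOL-Library.Product_Plus" "HOL-Library.Function_Algebras"
begin

text \<open>The symmetrized elements of [a,b) \<otimes> [c,d) under the tensor product of the canonical
  involutions form a six-dimensional space E = span(1, i+k, j, ij, l, kl) carrying the Albert form.
  If [a',b') \<otimes> [c',d') is the same algebra, the two involutions differ by an inner automorphism,
  hence there is a symmetrized intertwiner w, and left multiplication by w is a similitude between the
  two Albert forms. So both decompositions live in one quadratic space (E, q).

  There a decomposition is a vector v with q v \<noteq> 0 together with an orthogonal splitting of
  its orthogonal space into 3-dimensional spaces S1 and S2 through v, which determine the two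
  quaternion algebras. An edge of type I replaces v by an anisotropic vector x of S1 (and S2 by
  x plus a complement of v in S2), an edge of type II moves v inside the orthogonal space of complements
  of v in S1 and S2. Let two decompositions have base vectors v and t. After
  a reflection we may assume that v and t are not orthogonal and that there are anisotropic x in S1 and
  y in T1, orthogonal to v and t, with B x y = 1. Then the bases v, x, y, t form a
  path of type I, II, I; the two middle decompositions share the orthogonal space of v, t, x, y.
  The vectors exist as soon as the field has more than two elements; over the field with two elements
  all quaternion algebras are isomorphic.\<close>

subsection \<open>Isomorphism of algebras given by structure constants\<close>

text \<open>The algebra attached to S1 is the even Clifford algebra of q on S1: for y, y1 in S1 with
  B y y1 = 1, the products i = y y1 and j = v y present it as [q y * q y1, q v * q y). This algebra
  does not notice a scaling of q, which is why a similitude does the work of an isometry.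
  Presentations chosen separately on S1 and S2 satisfy a + c = q v * q w only up to some e^2 + e,
  where w completes v to a hyperbolic pair. The Albert form has trivial Arf invariant, and carrying
  this fact along with each basis allows the discrepancy to be absorbed. A type I edge then
  exchanges the planes (v, w) and (x, x1), and a type II edge exchanges v and w. The base vector is
  not determined by the vertex: an isometry of E moves the basis and keeps the vertex, so
  reflections are free to be spent on general position. A further obstacle is that algebras are mere
  tables of structure constants, with no associativity at hand. Computations take place in an
  arbitrary ring containing suitable generators, and one concrete ring, the endomorphisms of F^16,
  brings the results back to the tables.\<close>

definition alg_app :: "nat \<Rightarrow> (nat \<Rightarrow> nat \<Rightarrow> 'a::field) \<Rightarrow> (nat \<Rightarrow> 'a) \<Rightarrow> nat \<Rightarrow> 'a" where
  "alg_app n M X l = (\<Sum>k<n. X k * M k l)"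

definition alg_mul :: "'a::field alg \<Rightarrow> (nat \<Rightarrow> 'a) \<Rightarrow> (nat \<Rightarrow> 'a) \<Rightarrow> nat \<Rightarrow> 'a" where
  "alg_mul A X Y l = (\<Sum>p<fst A. \<Sum>q<fst A. X p * Y q * snd A p q l)"

lemma alg_app_cong: "(\<And>k. k < n \<Longrightarrow> X k = Y k) \<Longrightarrow> alg_app n M X l = alg_app n M Y l"
  by (simp add: alg_app_def)

lemma alg_mul_cong:
  "(\<And>k. k < fst A \<Longrightarrow> X k = X' k) \<Longrightarrow> (\<And>k. k < fst A \<Longrightarrow> Y k = Y' k) \<Longrightarrow>
   alg_mul A X Y l = alg_mul A X' Y' l"
  by (simp add: alg_mul_def)

lemma alg_app_app:
  "alg_app n N (alg_app n M X) l = alg_app n (\<lambda>i j. \<Sum>k<n. M i k * N k j) X l"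
  unfolding alg_app_def
  by (simp add: sum_distrib_left sum_distrib_right mult.assoc) (rule sum.swap)

lemma alg_app_mat_one:
  "(\<And>i j. i < n \<Longrightarrow> j < n \<Longrightarrow> M i j = (if i = j then 1 else 0)) \<Longrightarrow> l < n \<Longrightarrow>
   alg_app n M X l = X l"
proof -
  assume M: "\<And>i j. i < n \<Longrightarrow> j < n \<Longrightarrow> M i j = (if i = j then 1 else 0)" and l: "l < n"
  have "alg_app n M X l = (\<Sum>k<n. if k = l then X k else 0)"
    unfolding alg_app_def using l by (intro sum.cong refl) (simp add: M)
  with l show ?thesis by simp
qed

lemma alg_app_mul:
  assumes M: "\<And>i j l. i < fst A \<Longrightarrow> j < fst A \<Longrightarrow> l < fst A \<Longrightarrow>
      (\<Sum>k<fst A. snd A i j k * M k l) = (\<Sum>p<fst A. \<Sum>q<fst A. M i p * M j q * snd B p q l)"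
    and eq: "fst A = fst B" and l: "l < fst A"
  shows "alg_app (fst A) M (alg_mul A X Y) l
       = alg_mul B (alg_app (fst A) M X) (alg_app (fst A) M Y) l"
proof -
  let ?n = "fst A"
  have "alg_app ?n M (alg_mul A X Y) l
      = (\<Sum>k<?n. \<Sum>i<?n. \<Sum>j<?n. X i * Y j * (snd A i j k * M k l))"
    by (simp add: alg_app_def alg_mul_def sum_distrib_right mult.assoc)
  also have "\<dots> = (\<Sum>i<?n. \<Sum>k<?n. \<Sum>j<?n. X i * Y j * (snd A i j k * M k l))"
    by (rule sum.swap)
  also have "\<dots> = (\<Sum>i<?n. \<Sum>j<?n. \<Sum>k<?n. X i * Y j * (snd A i j k * M k l))"
    by (rule sum.cong[OF refl], rule sum.swap)
  also have "\<dots> = (\<Sum>i<?n. \<Sum>j<?n. X i * Y j * (\<Sum>p<?n. \<Sum>q<?n. M i p * M j q * snd B p q l))"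
    using l by (simp add: M flip: sum_distrib_left)
  also have "\<dots> = (\<Sum>i<?n. \<Sum>j<?n. \<Sum>p<?n. \<Sum>q<?n. X i * M i p * (Y j * M j q) * snd B p q l)"
    by (simp add: sum_distrib_left mult_ac)
  also have "\<dots> = (\<Sum>i<?n. \<Sum>p<?n. \<Sum>j<?n. \<Sum>q<?n. X i * M i p * (Y j * M j q) * snd B p q l)"
    by (rule sum.cong[OF refl], rule sum.swap)
  also have "\<dots> = (\<Sum>p<?n. \<Sum>i<?n. \<Sum>j<?n. \<Sum>q<?n. X i * M i p * (Y j * M j q) * snd B p q l)"
    by (rule sum.swap)
  also have "\<dots> = (\<Sum>p<?n. \<Sum>i<?n. \<Sum>q<?n. \<Sum>j<?n. X i * M i p * (Y j * M j q) * snd B p q l)"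
    by (rule sum.cong[OF refl], rule sum.cong[OF refl], rule sum.swap)
  also have "\<dots> = (\<Sum>p<?n. \<Sum>q<?n. \<Sum>i<?n. \<Sum>j<?n. X i * M i p * (Y j * M j q) * snd B p q l)"
    by (rule sum.cong[OF refl], rule sum.swap)
  also have "\<dots> = alg_mul B (alg_app ?n M X) (alg_app ?n M Y) l"
    unfolding alg_app_def alg_mul_def eq[symmetric]
    by (simp only: sum_product) (simp only: sum_distrib_right)
  finally show ?thesis .
qed

text \<open>Once the matrix identities are identities of maps on coordinate vectors, symmetry and
  transitivity reduce to composing maps. A vector is a function on all of nat, so equations are
  claimed only at coordinates below the dimension.\<close>

lemma alg_iso_iff_maps:
  "alg_iso A B \<longleftrightarrow> fst A = fst B \<and> (\<exists>M N.
     (\<forall>X. \<forall>l<fst A. alg_app (fst A) N (alg_app (fst A) M X) l = X l) \<and>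
     (\<forall>X. \<forall>l<fst A. alg_app (fst A) M (alg_app (fst A) N X) l = X l) \<and>
     (\<forall>X Y. \<forall>l<fst A. alg_app (fst A) M (alg_mul A X Y) l
        = alg_mul B (alg_app (fst A) M X) (alg_app (fst A) M Y) l))"
    (is "?L \<longleftrightarrow> ?R")
proof
  assume ?L
  then obtain M N where eq: "fst A = fst B"
    and 1: "\<forall>i<fst A. \<forall>j<fst A. (\<Sum>k<fst A. M i k * N k j) = (if i = j then 1 else 0)"
    and 2: "\<forall>i<fst A. \<forall>j<fst A. (\<Sum>k<fst A. N i k * M k j) = (if i = j then 1 else 0)"
    and 3: "\<forall>i<fst A. \<forall>j<fst A. \<forall>l<fst A. (\<Sum>k<fst A. snd A i j k * M k l)
          = (\<Sum>p<fst A. \<Sum>q<fst A. M i p * M j q * snd B p q l)"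
    unfolding alg_iso_def by auto
  show ?R
  proof (rule conjI[OF eq], rule exI[of _ M], rule exI[of _ N], intro conjI allI impI)
    fix X Y :: "nat \<Rightarrow> 'a" and l assume l: "l < fst A"
    show "alg_app (fst A) N (alg_app (fst A) M X) l = X l"
      unfolding alg_app_app by (rule alg_app_mat_one) (use 1 l in auto)
    show "alg_app (fst A) M (alg_app (fst A) N X) l = X l"
      unfolding alg_app_app by (rule alg_app_mat_one) (use 2 l in auto)
    show "alg_app (fst A) M (alg_mul A X Y) l
        = alg_mul B (alg_app (fst A) M X) (alg_app (fst A) M Y) l"
      by (rule alg_app_mul) (use 3 eq l in auto)
  qed
next
  assume ?R
  obtain M N where eq: "fst A = fst B"
    and 1: "\<And>X l. l < fst A \<Longrightarrow> alg_app (fst A) N (alg_app (fst A) M X) l = X l"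
    and 2: "\<And>X l. l < fst A \<Longrightarrow> alg_app (fst A) M (alg_app (fst A) N X) l = X l"
    and 3: "\<And>X Y l. l < fst A \<Longrightarrow> alg_app (fst A) M (alg_mul A X Y) l
        = alg_mul B (alg_app (fst A) M X) (alg_app (fst A) M Y) l"
    using \<open>?R\<close> by blast
  let ?n = "fst A"
  \<comment> \<open>Standard basis vectors: the maps evaluated there return the rows of the matrices
    and the structure constants.\<close>
  let ?e = "\<lambda>i k. if k = i then 1 else (0::'a)"
  have app_e: "alg_app ?n P (?e i) l = P i l" if "i < ?n" for P i l
    using that by (simp add: alg_app_def if_distrib[of "\<lambda>x. x * _"] cong: if_cong)
  have mul_e: "alg_mul A (?e i) (?e j) l = snd A i j l" if "i < ?n" "j < ?n" for i j l
  proof -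
    have delta: "(\<Sum>q<?n. (if q = j then 1 else 0) * f q) = f j" if "j < ?n" for j and f :: "nat \<Rightarrow> 'a"
      using that by (simp add: if_distrib[of "\<lambda>x. x * _"] cong: if_cong)
    show ?thesis
      using that by (simp add: alg_mul_def delta mult.assoc flip: sum_distrib_left)
  qed
  have MN: "(\<Sum>k<?n. P i k * Q k j) = (if i = j then 1 else 0)"
    if "\<And>X l. l < ?n \<Longrightarrow> alg_app ?n Q (alg_app ?n P X) l = X l" "i < ?n" "j < ?n" for P Q :: "nat \<Rightarrow> nat \<Rightarrow> 'a" and i j
  proof -
    have "(\<Sum>k<?n. P i k * Q k j) = alg_app ?n (\<lambda>i j. \<Sum>k<?n. P i k * Q k j) (?e i) j"
      using that by (simp add: app_e)
    also have "\<dots> = ?e i j"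
      using that by (simp add: alg_app_app[symmetric] del: if_split)
    finally show ?thesis by auto
  qed
  show ?L
    unfolding alg_iso_def
  proof (rule conjI[OF eq], rule exI[of _ M], rule exI[of _ N], intro conjI allI impI MN 1 2)
    fix i j l assume ijl: "i < ?n" "j < ?n" "l < ?n"
    have "(\<Sum>k<?n. snd A i j k * M k l) = alg_app ?n M (alg_mul A (?e i) (?e j)) l"
      unfolding alg_app_def using ijl mul_e by (intro sum.cong refl) auto
    also have "\<dots> = alg_mul B (alg_app ?n M (?e i)) (alg_app ?n M (?e j)) l"
      using ijl 3 by blast
    also have "\<dots> = alg_mul B (M i) (M j) l"
      using ijl by (intro alg_mul_cong) (auto simp: app_e)
    finally show "(\<Sum>k<?n. snd A i j k * M k l) = (\<Sum>p<?n. \<Sum>q<?n. M i p * M j q * snd B p q l)"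
      by (simp add: alg_mul_def eq)
  qed
qed

lemma alg_iso_refl: "alg_iso A A"
  unfolding alg_iso_iff_maps
proof (intro conjI exI allI impI refl)
  let ?I = "\<lambda>i j. if i = j then 1 else (0::'a)"
  have I: "alg_app n ?I X l = X l" if "l < n" for n X l
    using that by (rule alg_app_mat_one[rotated]) auto
  fix X Y :: "nat \<Rightarrow> 'a" and l assume l: "l < fst A"
  show "alg_app (fst A) ?I (alg_app (fst A) ?I X) l = X l"
    using l by (simp add: I)
  then show "alg_app (fst A) ?I (alg_app (fst A) ?I X) l = X l" .
  have "alg_mul A (alg_app (fst A) ?I X) (alg_app (fst A) ?I Y) l = alg_mul A X Y l"
    by (rule alg_mul_cong) (auto simp: I)
  then show "alg_app (fst A) ?I (alg_mul A X Y) l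
      = alg_mul A (alg_app (fst A) ?I X) (alg_app (fst A) ?I Y) l"
    using l by (simp add: I)
qed

lemma alg_iso_sym:
  assumes "alg_iso A B" shows "alg_iso B A"
proof -
  obtain M N where eq: "fst A = fst B"
    and 1: "\<And>X l. l < fst A \<Longrightarrow> alg_app (fst A) N (alg_app (fst A) M X) l = X l"
    and 2: "\<And>X l. l < fst A \<Longrightarrow> alg_app (fst A) M (alg_app (fst A) N X) l = X l"
    and 3: "\<And>X Y l. l < fst A \<Longrightarrow> alg_app (fst A) M (alg_mul A X Y) l
        = alg_mul B (alg_app (fst A) M X) (alg_app (fst A) M Y) l"
    using assms unfolding alg_iso_iff_maps by blast
  let ?M = "alg_app (fst A) M" and ?N = "alg_app (fst A) N"
  have "?N (alg_mul B X Y) l = alg_mul A (?N X) (?N Y) l" if l: "l < fst A" for X Y l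
  proof -
    have "alg_mul B X Y k = ?M (alg_mul A (?N X) (?N Y)) k" if "k < fst A" for k
      using that eq 2 by (subst 3) (auto intro!: alg_mul_cong)
    then have "?N (alg_mul B X Y) l = ?N (?M (alg_mul A (?N X) (?N Y))) l"
      by (rule alg_app_cong)
    then show ?thesis using 1 l by simp
  qed
  then show ?thesis
    unfolding alg_iso_iff_maps eq[symmetric] using 1 2
    by (intro conjI refl, rule_tac exI[of _ N], rule_tac exI[of _ M]) auto
qed

lemma alg_iso_trans:
  assumes "alg_iso A B" "alg_iso B C" shows "alg_iso A C"
proof -
  obtain M N where eq: "fst A = fst B"
    and 1: "\<And>X l. l < fst A \<Longrightarrow> alg_app (fst A) N (alg_app (fst A) M X) l = X l"
    and 2: "\<And>X l. l < fst A \<Longrightarrow> alg_app (fst A) M (alg_app (fst A) N X) l = X l"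
    and 3: "\<And>X Y l. l < fst A \<Longrightarrow> alg_app (fst A) M (alg_mul A X Y) l
        = alg_mul B (alg_app (fst A) M X) (alg_app (fst A) M Y) l"
    using assms(1) unfolding alg_iso_iff_maps by blast
  obtain P Q where eq': "fst A = fst C"
    and 4: "\<And>X l. l < fst A \<Longrightarrow> alg_app (fst A) Q (alg_app (fst A) P X) l = X l"
    and 5: "\<And>X l. l < fst A \<Longrightarrow> alg_app (fst A) P (alg_app (fst A) Q X) l = X l"
    and 6: "\<And>X Y l. l < fst A \<Longrightarrow> alg_app (fst A) P (alg_mul B X Y) l
        = alg_mul C (alg_app (fst A) P X) (alg_app (fst A) P Y) l"
    using assms(2) unfolding alg_iso_iff_maps eq[symmetric] by blast
  let ?n = "fst A"
  let ?MP = "\<lambda>i j. \<Sum>k<?n. M i k * P k j" and ?QN = "\<lambda>i j. \<Sum>k<?n. Q i k * N k j"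
  have MP: "alg_app ?n ?MP X l = alg_app ?n P (alg_app ?n M X) l"
    and QN: "alg_app ?n ?QN X l = alg_app ?n N (alg_app ?n Q X) l" for X l
    by (simp_all add: alg_app_app)
  have *: "alg_app ?n ?MP (alg_mul A X Y) l = alg_mul C (alg_app ?n ?MP X) (alg_app ?n ?MP Y) l"
    if l: "l < ?n" for X Y l
  proof -
    have "alg_app ?n ?MP (alg_mul A X Y) l = alg_app ?n P (alg_mul B (alg_app ?n M X) (alg_app ?n M Y)) l"
      unfolding MP by (rule alg_app_cong) (rule 3)
    also have "\<dots> = alg_mul C (alg_app ?n ?MP X) (alg_app ?n ?MP Y) l"
      using l by (subst 6) (auto simp: MP intro!: alg_mul_cong)
    finally show ?thesis .
  qed
  have **: "alg_app ?n ?QN (alg_app ?n ?MP X) l = X l" "alg_app ?n ?MP (alg_app ?n ?QN X) l = X l"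
    if l: "l < ?n" for X l
  proof -
    have "alg_app ?n ?QN (alg_app ?n ?MP X) l = alg_app ?n N (alg_app ?n M X) l"
      unfolding QN by (intro alg_app_cong) (simp add: MP[abs_def] 4)
    then show "alg_app ?n ?QN (alg_app ?n ?MP X) l = X l" using l 1 by simp
    have "alg_app ?n ?MP (alg_app ?n ?QN X) l = alg_app ?n P (alg_app ?n Q X) l"
      unfolding MP by (intro alg_app_cong) (simp add: QN[abs_def] 2)
    then show "alg_app ?n ?MP (alg_app ?n ?QN X) l = X l" using l 5 by simp
  qed
  show ?thesis
    unfolding alg_iso_iff_maps
    by (rule conjI[OF eq'], rule exI[of _ ?MP], rule exI[of _ ?QN]) (intro conjI allI impI * **)
qed

lemma sum_lessThan_mult:
  fixes F :: "nat \<Rightarrow> nat \<Rightarrow> 'b::comm_monoid_add"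
  assumes "0 < m"
  shows "(\<Sum>k<n * m. F (k div m) (k mod m)) = (\<Sum>i<n. \<Sum>j<m. F i j)"
proof -
  have "(\<Sum>k<n * m. F (k div m) (k mod m)) = (\<Sum>(i, j)\<in>{..<n} \<times> {..<m}. F i j)"
  proof (rule sum.reindex_bij_witness[where i = "\<lambda>(i, j). i * m + j" and j = "\<lambda>k. (k div m, k mod m)"], goal_cases)
    case (2 a)
    then show ?case using assms by (auto simp: less_mult_imp_div_less)
  next
    case (4 b)
    then obtain i j where b: "b = (i, j)" "i < n" "j < m" by auto
    then have "i * m + j < Suc i * m" by simp
    also have "\<dots> \<le> n * m" using b by (intro mult_le_mono1) auto
    finally show ?case using b by simp
  qed (use assms in auto)
  then show ?thesis by (simp add: sum.cartesian_product)
qed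

lemma sum_div_mod:
  fixes f g :: "nat \<Rightarrow> 'b::semiring_0"
  assumes "0 < m"
  shows "(\<Sum>k<n * m. f (k div m) * g (k mod m)) = (\<Sum>i<n. f i) * (\<Sum>j<m. g j)"
  using sum_lessThan_mult[OF assms, of "\<lambda>i j. f i * g j" n] by (simp add: sum_product)

lemma alg_iso_tensor:
  assumes "alg_iso A A'" "alg_iso B B'"
  shows "alg_iso (alg_tensor A B) (alg_tensor A' B')"
proof (cases "fst B = 0")
  \<comment> \<open>\<open>div\<close> and \<open>mod\<close> by \<open>fst B\<close> split an index
    only if \<open>fst B\<close> is positive; in dimension 0 every condition is vacuous.\<close>
  case True
  then have "fst B' = 0" using assms(2) by (simp add: alg_iso_def)
  with True show ?thesis by (simp add: alg_iso_def alg_tensor_def)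
next
  case False
  let ?n = "fst A" and ?m = "fst B"
  obtain M N where eq: "?n = fst A'"
    and 1: "\<forall>i<?n. \<forall>j<?n. (\<Sum>k<?n. M i k * N k j) = (if i = j then 1 else 0)"
    and 2: "\<forall>i<?n. \<forall>j<?n. (\<Sum>k<?n. N i k * M k j) = (if i = j then 1 else 0)"
    and 3: "\<forall>i<?n. \<forall>j<?n. \<forall>l<?n. (\<Sum>k<?n. snd A i j k * M k l)
          = (\<Sum>p<?n. \<Sum>q<?n. M i p * M j q * snd A' p q l)"
    using assms(1) unfolding alg_iso_def by (elim conjE exE) (rule that)
  obtain P Q where eq': "?m = fst B'"
    and 4: "\<forall>i<?m. \<forall>j<?m. (\<Sum>k<?m. P i k * Q k j) = (if i = j then 1 else 0)"
    and 5: "\<forall>i<?m. \<forall>j<?m. (\<Sum>k<?m. Q i k * P k j) = (if i = j then 1 else 0)"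
    and 6: "\<forall>i<?m. \<forall>j<?m. \<forall>l<?m. (\<Sum>k<?m. snd B i j k * P k l)
          = (\<Sum>p<?m. \<Sum>q<?m. P i p * P j q * snd B' p q l)"
    using assms(2) unfolding alg_iso_def by (elim conjE exE) (rule that)
  have m: "0 < ?m" using False by simp
  have dm: "i div ?m < ?n" "i mod ?m < ?m" if "i < ?n * ?m" for i
    using that m by (auto simp: less_mult_imp_div_less)
  have id: "(i = j) \<longleftrightarrow> i div ?m = j div ?m \<and> i mod ?m = j mod ?m" for i j
    by (metis div_mult_mod_eq)
  \<comment> \<open>Kronecker products of the two base changes. Every sum over the product index
    factors into a sum for each factor.\<close>
  let ?MP = "\<lambda>i j. M (i div ?m) (j div ?m) * P (i mod ?m) (j mod ?m)"
  let ?NQ = "\<lambda>i j. N (i div ?m) (j div ?m) * Q (i mod ?m) (j mod ?m)"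
  have fac: "(\<Sum>k<?n * ?m. (f (k div ?m) * g (k mod ?m)) * (f' (k div ?m) * g' (k mod ?m)))
      = (\<Sum>k<?n. f k * f' k) * (\<Sum>k<?m. g k * g' k)" for f g f' g' :: "nat \<Rightarrow> 'a"
    using sum_div_mod[OF m, of "\<lambda>k. f k * f' k" "\<lambda>k. g k * g' k" ?n] by (simp add: mult_ac)
  have fac2: "(\<Sum>p<?n * ?m. \<Sum>q<?n * ?m. (a (p div ?m) * b (p mod ?m)) * (a' (q div ?m) * b' (q mod ?m))
        * (f (p div ?m) (q div ?m) * g (p mod ?m) (q mod ?m)))
      = (\<Sum>p<?n. \<Sum>q<?n. a p * a' q * f p q) * (\<Sum>p<?m. \<Sum>q<?m. b p * b' q * g p q)"
    for a b a' b' :: "nat \<Rightarrow> 'a" and f g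
  proof -
    have "(\<Sum>q<?n * ?m. (a p * b p') * (a' (q div ?m) * b' (q mod ?m)) * (f p (q div ?m) * g p' (q mod ?m)))
        = (\<Sum>q<?n. a p * a' q * f p q) * (\<Sum>q<?m. b p' * b' q * g p' q)" for p p'
      using sum_div_mod[OF m, of "\<lambda>q. a p * a' q * f p q" "\<lambda>q. b p' * b' q * g p' q" ?n]
      by (simp add: mult_ac)
    then show ?thesis
      using sum_div_mod[OF m, of "\<lambda>p. \<Sum>q<?n. a p * a' q * f p q" "\<lambda>p. \<Sum>q<?m. b p * b' q * g p q" ?n]
      by simp
  qed
  show ?thesis
    unfolding alg_iso_def alg_tensor_def fst_conv snd_conv eq[symmetric] eq'[symmetric]
  proof (rule conjI, rule refl, rule exI[of _ ?MP], rule exI[of _ ?NQ], intro conjI allI impI)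
    fix i j assume i: "i < ?n * ?m" and j: "j < ?n * ?m"
    show "(\<Sum>k<?n * ?m. ?MP i k * ?NQ k j) = (if i = j then 1 else 0)"
      using fac[of "M (i div ?m)" "P (i mod ?m)" "\<lambda>k. N k (j div ?m)" "\<lambda>k. Q k (j mod ?m)"]
        dm[OF i] dm[OF j] 1 4 id[of i j] by simp
    show "(\<Sum>k<?n * ?m. ?NQ i k * ?MP k j) = (if i = j then 1 else 0)"
      using fac[of "N (i div ?m)" "Q (i mod ?m)" "\<lambda>k. M k (j div ?m)" "\<lambda>k. P k (j mod ?m)"]
        dm[OF i] dm[OF j] 2 5 id[of i j] by simp
    fix l assume l: "l < ?n * ?m"
    show "(\<Sum>k<?n * ?m. snd A (i div ?m) (j div ?m) (k div ?m) * snd B (i mod ?m) (j mod ?m) (k mod ?m)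
          * ?MP k l)
        = (\<Sum>p<?n * ?m. \<Sum>q<?n * ?m. ?MP i p * ?MP j q
          * (snd A' (p div ?m) (q div ?m) (l div ?m) * snd B' (p mod ?m) (q mod ?m) (l mod ?m)))"
      using fac[of "snd A (i div ?m) (j div ?m)" "snd B (i mod ?m) (j mod ?m)"
          "\<lambda>k. M k (l div ?m)" "\<lambda>k. P k (l mod ?m)"]
        fac2[of "M (i div ?m)" "P (i mod ?m)" "M (j div ?m)" "P (j mod ?m)"
          "\<lambda>p q. snd A' p q (l div ?m)" "\<lambda>p q. snd B' p q (l mod ?m)"]
        dm[OF i] dm[OF j] dm[OF l] 3 6 by simp
  qed
qed

subsection \<open>Algebras over a field as rings\<close>

text \<open>Associativity is obtained by realizing algebras as spans of families inside a ring, with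
  \<open>s\<close> embedding the scalars centrally. The ring may be much larger than the algebra
  under study.\<close>

locale F_algebra =
  fixes s :: "'a::field \<Rightarrow> 'r::ring_1"
  assumes s_add: "s (x + y) = s x + s y"
    and s_mult: "s (x * y) = s x * s y"
    and s_one: "s 1 = 1"
    and s_central: "r * s c = s c * r"
    and char2: "(1::'a) + 1 = 0"
begin

lemma s_zero: "s 0 = 0"
  using s_add[of 0 0] by simp

lemma s_inj0: "s c = 0 \<longleftrightarrow> c = 0"
proof
  assume "s c = 0"
  then have "s (c * inverse c) = 0" by (simp add: s_mult)
  then show "c = 0" by (cases "c = 0") (simp_all add: s_one)
qed (simp add: s_zero)

lemma s_cancel: "c \<noteq> 0 \<Longrightarrow> s c * x = 0 \<longleftrightarrow> x = 0"
proof
  assume c: "c \<noteq> 0" and "s c * x = 0"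
  then have "s (inverse c * c) * x = 0" by (simp only: s_mult mult.assoc mult_zero_right)
  with c show "x = 0" by (simp add: s_one del: mult_eq_0_iff)
qed simp

lemma add_self: "(x::'r) + x = 0"
proof -
  have "x + x = (s 1 + s 1) * x" by (simp only: distrib_right s_one mult_1)
  also have "\<dots> = s (1 + 1) * x" by (simp only: s_add)
  also have "\<dots> = 0" by (simp only: char2 s_zero mult_zero_left)
  finally show ?thesis .
qed

lemma add_self_left: "(x::'r) + (x + y) = y"
  by (simp add: add_self flip: add.assoc)

lemma add_self_F: "(x::'a) + x = 0"
proof -
  have "x + x = (1 + 1) * x" by (simp only: distrib_right mult_1)
  also have "\<dots> = 0" by (simp only: char2 mult_zero_left)
  finally show ?thesis .
qed

lemma add_self_left_F: "(x::'a) + (x + y) = y"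
  by (simp add: add_self_F flip: add.assoc)

lemma add_eq_0_F: "(x::'a) + y = 0 \<longleftrightarrow> x = y"
  using add_self_F[of y] by (metis add_right_cancel)

lemma add_eq_0: "(x::'r) + y = 0 \<longleftrightarrow> x = y"
  by (metis add_self add_right_cancel)

lemma s_left: "r * (s c * z) = s c * (r * z)"
  by (simp only: mult.assoc[symmetric] s_central[of r])

lemma s_s: "s c * (s c' * z) = s (c * c') * z"
  by (simp only: s_mult mult.assoc)

lemma s_sum: "s (sum f A) = (\<Sum>x\<in>A. s (f x))"
  by (induction A rule: infinite_finite_induct) (simp_all add: s_zero s_add)

definition lin :: "nat \<Rightarrow> (nat \<Rightarrow> 'r) \<Rightarrow> (nat \<Rightarrow> 'a) \<Rightarrow> 'r" where
  "lin n h X = (\<Sum>p<n. s (X p) * h p)"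

lemma lin_cong: "(\<And>k. k < n \<Longrightarrow> X k = Y k) \<Longrightarrow> lin n h X = lin n h Y"
  by (simp add: lin_def)

lemma lin_add: "lin n h X + lin n h Y = lin n h (\<lambda>k. X k + Y k)"
  by (simp add: lin_def s_add distrib_right sum.distrib)

lemma lin_scale: "s c * lin n h X = lin n h (\<lambda>k. c * X k)"
  by (simp add: lin_def s_mult sum_distrib_left mult.assoc)

lemma lin_basis: "p < n \<Longrightarrow> lin n h (\<lambda>k. if k = p then 1 else 0) = h p"
  by (simp add: lin_def if_distrib[of s] if_distrib[of "\<lambda>x. x * _"] s_one s_zero cong: if_cong)

lemma lin_lin: "lin n (\<lambda>p. lin m g (M p)) X = lin m g (\<lambda>k. \<Sum>p<n. X p * M p k)"
  unfolding lin_def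
  by (simp add: s_sum s_mult sum_distrib_left sum_distrib_right mult.assoc) (rule sum.swap)

lemma lin_mult:
  assumes h: "\<And>p q. p < n \<Longrightarrow> q < n \<Longrightarrow> h p * h q = lin m g (sc p q)"
  shows "lin n h X * lin n h Y = lin m g (\<lambda>k. \<Sum>p<n. \<Sum>q<n. X p * Y q * sc p q k)"
proof -
  have "lin n h X * lin n h Y = (\<Sum>p<n. \<Sum>q<n. s (X p * Y q) * (h p * h q))"
    unfolding lin_def sum_product
  proof (intro sum.cong refl)
    fix p q
    have "s (X p) * h p * (s (Y q) * h q) = s (X p) * (h p * s (Y q)) * h q"
      by (simp only: mult.assoc)
    then show "s (X p) * h p * (s (Y q) * h q) = s (X p * Y q) * (h p * h q)"
      by (simp only: s_central[of "h p"] s_mult mult.assoc)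
  qed
  also have "\<dots> = (\<Sum>p<n. \<Sum>q<n. \<Sum>k<m. s (X p * Y q * sc p q k) * g k)"
    by (intro sum.cong refl) (simp add: h lin_def sum_distrib_left s_mult mult.assoc)
  also have "\<dots> = (\<Sum>p<n. \<Sum>k<m. \<Sum>q<n. s (X p * Y q * sc p q k) * g k)"
    by (rule sum.cong[OF refl], rule sum.swap)
  also have "\<dots> = (\<Sum>k<m. \<Sum>p<n. \<Sum>q<n. s (X p * Y q * sc p q k) * g k)"
    by (rule sum.swap)
  also have "\<dots> = lin m g (\<lambda>k. \<Sum>p<n. \<Sum>q<n. X p * Y q * sc p q k)"
    by (simp add: lin_def s_sum sum_distrib_right)
  finally show ?thesis .
qed

definition indep :: "nat \<Rightarrow> (nat \<Rightarrow> 'r) \<Rightarrow> bool" where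
  "indep n h \<longleftrightarrow> (\<forall>X. lin n h X = 0 \<longrightarrow> (\<forall>p<n. X p = 0))"

lemma indepD: "indep n h \<Longrightarrow> lin n h X = lin n h Y \<Longrightarrow> p < n \<Longrightarrow> X p = Y p"
proof -
  assume h: "indep n h" and eq: "lin n h X = lin n h Y" and p: "p < n"
  have "lin n h (\<lambda>k. X k + Y k) = 0"
    by (simp add: eq add_self flip: lin_add)
  with h p have "X p + Y p = 0" unfolding indep_def by blast
  then show "X p = Y p" by (simp add: add_eq_0_F)
qed

lemma vector_space_s: "vector_space (\<lambda>c x. s c * x)"
  by unfold_locales (simp_all add: distrib_left distrib_right s_add s_s s_one)

lemma span_image_lin:
  "module.span (\<lambda>c x. s c * x) (h ` {..<n}) \<subseteq> range (lin n h)"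
proof -
  interpret V: vector_space "\<lambda>c x. s c * x" by (rule vector_space_s)
  have "V.subspace (range (lin n h))"
  proof (rule V.subspaceI)
    have "lin n h (\<lambda>_. 0) = 0" by (simp add: lin_def s_zero)
    then show "0 \<in> range (lin n h)" by (metis rangeI)
  qed (auto simp: lin_add lin_scale)
  moreover have "h ` {..<n} \<subseteq> range (lin n h)"
  proof
    fix x assume "x \<in> h ` {..<n}"
    then obtain p where "p < n" "x = h p" by blast
    then have "x = lin n h (\<lambda>k. if k = p then 1 else 0)" by (simp add: lin_basis)
    then show "x \<in> range (lin n h)" by blast
  qed
  ultimately show ?thesis by (rule V.span_minimal[rotated])
qed

text \<open>Exchange argument: a \<open>g p\<close> outside the span of the n independent vectors h
  would yield n + 1 independent vectors in the span of the n vectors g.\<close>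

lemma indep_spans:
  assumes h: "indep n h" and hg: "\<And>p. p < n \<Longrightarrow> h p \<in> range (lin n g)" and p: "p < n"
  shows "g p \<in> range (lin n h)"
proof (rule ccontr)
  assume "g p \<notin> range (lin n h)"
  interpret V: vector_space "\<lambda>c x. s c * x" by (rule vector_space_s)
  let ?H = "h ` {..<n}" and ?G = "g ` {..<n}"
  have inj: "inj_on h {..<n}"
  proof (rule inj_onI)
    fix p q assume pq: "p \<in> {..<n}" "q \<in> {..<n}" "h p = h q"
    then have "lin n h (\<lambda>k. if k = p then 1 else 0) = lin n h (\<lambda>k. if k = q then 1 else 0)"
      by (simp add: lin_basis)
    from indepD[OF h this, of p] pq show "p = q" by (auto split: if_splits)
  qed
  have "V.independent ?H"
  proof (rule V.independent_if_scalars_zero)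
    fix f x assume f: "(\<Sum>x\<in>?H. s (f x) * x) = 0" and x: "x \<in> ?H"
    have "lin n h (\<lambda>p. f (h p)) = 0"
      using f by (simp add: lin_def sum.reindex[OF inj])
    then show "f x = 0" using h x unfolding indep_def by blast
  qed simp
  moreover have "g p \<notin> V.span ?H"
    using \<open>g p \<notin> range (lin n h)\<close> span_image_lin by blast
  ultimately have ind: "V.independent (insert (g p) ?H)"
    by (simp add: V.independent_insert)
  have "lin n g X \<in> V.span ?G" for X
    unfolding lin_def by (rule V.span_sum) (rule V.span_scale, rule V.span_base, rule imageI)
  then have "range (lin n g) \<subseteq> V.span ?G" by blast
  then have "insert (g p) ?H \<subseteq> V.span ?G"
    using hg p V.span_base[of "g p" ?G] by blast
  then have "card (insert (g p) ?H) \<le> card ?G"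
    using V.independent_span_bound[OF _ ind] by simp
  also have "card ?G \<le> n" using card_image_le[of "{..<n}" g] by simp
  finally have "card (insert (g p) ?H) \<le> n" .
  moreover have "g p \<notin> ?H" using \<open>g p \<notin> V.span ?H\<close> V.span_base[of "g p" ?H] by blast
  ultimately show False by (simp add: card_image[OF inj])
qed

text \<open>Only one inclusion of spans has to be checked, since equal size gives the other; the
  inverse matrix is never computed. Changes of presentation are proved in this way, by exhibiting
  new generators inside the old algebra.\<close>

lemma alg_iso_of_indep:
  assumes h: "indep n h" and g: "indep n g"
    and hg: "\<And>p. p < n \<Longrightarrow> h p \<in> range (lin n g)"
    and hh: "\<And>p q. p < n \<Longrightarrow> q < n \<Longrightarrow> h p * h q = lin n h (scA p q)"
    and gg: "\<And>p q. p < n \<Longrightarrow> q < n \<Longrightarrow> g p * g q = lin n g (scB p q)"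
  shows "alg_iso (n, scA) (n, scB)"
proof -
  have change: "lin n h' X = lin n g' (\<lambda>k. \<Sum>p<n. X p * M p k)"
    if "\<And>p. p < n \<Longrightarrow> h' p = lin n g' (M p)" for h' g' M X
  proof -
    have "lin n h' X = lin n (\<lambda>p. lin n g' (M p)) X"
      unfolding lin_def[of n h'] lin_def[of n "\<lambda>p. lin n g' (M p)"] by (simp add: that)
    then show ?thesis by (simp only: lin_lin)
  qed
  define M where "M p = (SOME X. h p = lin n g X)" for p
  define N where "N p = (SOME X. g p = lin n h X)" for p
  have M: "h p = lin n g (M p)" if "p < n" for p
  proof -
    have "\<exists>X. h p = lin n g X" using hg[OF that] by blast
    then show ?thesis unfolding M_def by (rule someI_ex)
  qed
  have N: "g p = lin n h (N p)" if "p < n" for p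
  proof -
    have "\<exists>X. g p = lin n h X" using indep_spans[OF h hg that] by blast
    then show ?thesis unfolding N_def by (rule someI_ex)
  qed
  have inverse: "(\<Sum>k<n. M' i k * N' k j) = (if i = j then 1 else 0)"
    if "indep n h'" "i < n" "j < n" "\<And>p. p < n \<Longrightarrow> h' p = lin n g' (M' p)"
      "\<And>p. p < n \<Longrightarrow> g' p = lin n h' (N' p)" for h' g' M' N' i j
  proof -
    have "lin n h' (\<lambda>j. \<Sum>k<n. M' i k * N' k j) = lin n g' (M' i)"
      using change[of g' h' N' "M' i"] that(5) by simp
    also have "\<dots> = lin n h' (\<lambda>k. if k = i then 1 else 0)"
      using that by (simp add: lin_basis)
    finally have "(\<Sum>k<n. M' i k * N' k j) = (if j = i then 1 else 0)"
      by (rule indepD[OF that(1) _ that(3)])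
    then show ?thesis by (simp add: eq_commute)
  qed
  have 3: "(\<Sum>k<n. scA i j k * M k l) = (\<Sum>p<n. \<Sum>q<n. M i p * M j q * scB p q l)"
    if ijl: "i < n" "j < n" "l < n" for i j l
  proof (rule indepD[OF g _ ijl(3)])
    have "lin n g (\<lambda>l. \<Sum>k<n. scA i j k * M k l) = lin n h (scA i j)"
      using change[of h g M "scA i j"] M by simp
    also have "\<dots> = lin n g (M i) * lin n g (M j)"
      using ijl by (simp only: M[symmetric] hh)
    also have "\<dots> = lin n g (\<lambda>l. \<Sum>p<n. \<Sum>q<n. M i p * M j q * scB p q l)"
      by (rule lin_mult) (rule gg)
    finally show "lin n g (\<lambda>l. \<Sum>k<n. scA i j k * M k l)
        = lin n g (\<lambda>l. \<Sum>p<n. \<Sum>q<n. M i p * M j q * scB p q l)" .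
  qed
  show ?thesis
    unfolding alg_iso_def fst_conv snd_conv
  proof (rule conjI, rule refl, rule exI[of _ M], rule exI[of _ N], intro conjI allI impI)
    fix i j assume ij: "i < n" "j < n"
    show "(\<Sum>k<n. M i k * N k j) = (if i = j then 1 else 0)"
      by (rule inverse[OF h ij M N])
    show "(\<Sum>k<n. N i k * M k j) = (if i = j then 1 else 0)"
      by (rule inverse[OF g ij N M])
    fix l assume "l < n"
    with ij show "(\<Sum>k<n. scA i j k * M k l) = (\<Sum>p<n. \<Sum>q<n. M i p * M j q * scB p q l)"
      by (rule 3)
  qed
qed

end

subsection \<open>Quaternion pairs\<close>

definition quat_basis :: "'r::ring_1 \<Rightarrow> 'r \<Rightarrow> nat \<Rightarrow> 'r" where
  "quat_basis i j p = (if p = 0 then 1 else if p = 1 then i else if p = 2 then j else i * j)"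

lemma less_4_iff: "(p::nat) < 4 \<longleftrightarrow> p = 0 \<or> p = 1 \<or> p = 2 \<or> p = 3"
  by auto

lemma sum_lessThan_4: "sum f {..<4::nat} = f 0 + f 1 + f 2 + f 3"
  by (simp add: eval_nat_numeral)

lemma quat_basis_simps [simp]:
  "quat_basis i j 0 = 1" "quat_basis i j (Suc 0) = i" "quat_basis i j 1 = i" "quat_basis i j 2 = j"
  "quat_basis i j 3 = i * j"
  "quat_basis i j (Suc (Suc 0)) = j" "quat_basis i j (Suc (Suc (Suc 0))) = i * j"
  by (simp_all add: quat_basis_def)

context F_algebra
begin

lemma lin_4: "lin 4 h X = s (X 0) * h 0 + s (X 1) * h 1 + s (X 2) * h 2 + s (X 3) * h 3"
  by (simp add: lin_def sum_lessThan_4)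

lemma lin_commute: "(\<And>p. p < n \<Longrightarrow> x * h p = h p * x) \<Longrightarrow> x * lin n h X = lin n h X * x"
proof -
  assume h: "\<And>p. p < n \<Longrightarrow> x * h p = h p * x"
  have "x * (s (X p) * h p) = s (X p) * h p * x" if "p < n" for p
    using h[OF that] by (simp only: mult.assoc[symmetric] s_central[of x]) (simp only: mult.assoc)
  then show ?thesis by (simp add: lin_def sum_distrib_left sum_distrib_right)
qed

lemma lin_prod:
  assumes "0 < m"
  shows "lin n e X * lin m f Y
    = lin (n * m) (\<lambda>p. e (p div m) * f (p mod m)) (\<lambda>p. X (p div m) * Y (p mod m))"
proof -
  have "s (X p) * e p * (s (Y q) * f q) = s (X p * Y q) * (e p * f q)" for p q
    by (simp only: mult.assoc s_left[of "e p"] s_s)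
  then show ?thesis
    using sum_lessThan_mult[OF assms, of "\<lambda>p q. s (X p * Y q) * (e p * f q)" n]
    by (simp add: lin_def sum_product)
qed

end

locale quat_pair = F_algebra s for s :: "'a::field \<Rightarrow> 'r::ring_1" +
  fixes a b :: 'a and i j :: 'r
  assumes ii: "i * i = i + s a" and jj: "j * j = s b" and ji: "j * i = i * j + j"
    and b_nz: "b \<noteq> 0"
begin

lemma iiz: "i * (i * z) = i * z + s a * z"
  by (metis distrib_right ii mult.assoc)

lemma jjz: "j * (j * z) = s b * z"
  by (metis jj mult.assoc)

lemma jiz: "j * (i * z) = i * (j * z) + j * z"
  by (metis distrib_right ji mult.assoc)

lemmas s_ij = s_central[of i] s_central[of j] s_left[of i] s_left[of j]

lemmas quat_norm = ii jj ji iiz jjz jiz s_ij distrib_left distrib_right mult.assoc s_s s_mult[symmetric]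
  add_self add_self_left add_ac

lemma quat_basis_mult:
  assumes "p < 4" "q < 4"
  shows "quat_basis i j p * quat_basis i j q = lin 4 (quat_basis i j) (quat_prod a b p q)"
  using assms unfolding less_4_iff
  by (elim disjE; simp only:; simp add: lin_4 quat_prod_def vec4_def s_zero s_one quat_norm mult.commute)

text \<open>The coefficients are ring elements commuting with i and j rather than scalars, so that
  they may come from the second tensor factor. The commutator of z with j is
  \<open>j * x1 + s b * x3\<close>, and a further commutator with i isolates \<open>j * x1\<close>;
  after that, the commutator of z with i is \<open>j * x2\<close>. Since j^2 is a nonzero scalar, j
  can be cancelled.\<close>

lemma coeff_central:
  assumes z: "z = x0 + i * x1 + j * x2 + i * j * x3" "z * i = i * z" "z * j = j * z"
    and comm: "\<And>x. x \<in> {x0, x1, x2, x3} \<Longrightarrow> x * i = i * x" "\<And>x. x \<in> {x0, x1, x2, x3} \<Longrightarrow> x * j = j * x"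
  shows "x1 = 0" "x2 = 0" "x3 = 0"
proof -
  have xi: "x0 * i = i * x0" "x1 * i = i * x1" "x2 * i = i * x2" "x3 * i = i * x3"
    and xj: "x0 * j = j * x0" "x1 * j = j * x1" "x2 * j = j * x2" "x3 * j = j * x3"
    using comm by auto
  have y: "j * x1 + s b * x3 = 0"
  proof -
    have "j * z + z * j = j * x1 + s b * x3"
      unfolding z(1) by (simp add: xi xj quat_norm)
    then show ?thesis by (simp add: z(3) add_self)
  qed
  have "j * x1 = 0"
  proof -
    have "(j * x1 + s b * x3) * i + i * (j * x1 + s b * x3) = j * x1"
      by (simp add: xi xj quat_norm)
    then show ?thesis unfolding y by simp
  qed
  then have "s b * x1 = 0" by (metis jjz mult_zero_right)
  then show x1: "x1 = 0" using b_nz s_cancel by blast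
  from y show x3: "x3 = 0" using b_nz s_cancel by (simp add: x1)
  have "j * x2 = 0"
  proof -
    have "i * z + z * i = j * x2"
      unfolding z(1) by (simp add: xi xj quat_norm x1 x3)
    then show ?thesis by (simp add: z(2) add_self)
  qed
  then have "s b * x2 = 0" by (metis jjz mult_zero_right)
  then show x2: "x2 = 0" using b_nz s_cancel by blast
qed

lemma coeff_zero:
  assumes "x0 + i * x1 + j * x2 + i * j * x3 = 0"
    and comm: "\<And>x. x \<in> {x0, x1, x2, x3} \<Longrightarrow> x * i = i * x" "\<And>x. x \<in> {x0, x1, x2, x3} \<Longrightarrow> x * j = j * x"
  shows "x0 = 0" "x1 = 0" "x2 = 0" "x3 = 0"
proof -
  show "x1 = 0" "x2 = 0" "x3 = 0"
    by (rule coeff_central[OF assms(1)[symmetric]]; use comm in auto)+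
  then show "x0 = 0" using assms(1) by simp
qed

text \<open>The relations alone force independence, so any two ring elements satisfying them span a
  faithful copy of \<open>quat a b\<close>.\<close>

lemma quat_indep: "indep 4 (quat_basis i j)"
  unfolding indep_def
proof (intro allI impI)
  fix X :: "nat \<Rightarrow> 'a" and p :: nat assume X: "lin 4 (quat_basis i j) X = 0" and p: "p < 4"
  have "s (X 0) + i * s (X 1) + j * s (X 2) + i * j * s (X 3) = 0"
    using X by (simp add: lin_4 s_central[symmetric])
  then have "s (X 0) = 0" "s (X 1) = 0" "s (X 2) = 0" "s (X 3) = 0"
    by (rule coeff_zero; auto simp: s_ij)+
  with p show "X p = 0" by (auto simp: less_4_iff s_inj0)
qed

lemma quat_basis_commute:
  "x * i = i * x \<Longrightarrow> x * j = j * x \<Longrightarrow> x * quat_basis i j p = quat_basis i j p * x"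
  unfolding quat_basis_def by (simp add: mult.assoc[symmetric]) (simp add: mult.assoc)

end

lemma alg_iso_quat:
  assumes "quat_pair s a b i j" "quat_pair s c d k l"
    and "k = F_algebra.lin s 4 (quat_basis i j) X" "l = F_algebra.lin s 4 (quat_basis i j) Y"
  shows "alg_iso (quat c d) (quat a b)"
proof -
  interpret P: quat_pair s a b i j by fact
  interpret Q: quat_pair s c d k l by fact
  have "quat_basis k l p \<in> range (P.lin 4 (quat_basis i j))" for p
  proof -
    have "1 \<in> range (P.lin 4 (quat_basis i j))"
      using P.lin_basis[of 0 4 "quat_basis i j"] by (metis quat_basis_simps(1) zero_less_numeral rangeI)
    moreover have "k * l \<in> range (P.lin 4 (quat_basis i j))"
      unfolding assms(3,4) by (subst P.lin_mult[OF P.quat_basis_mult]) auto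
    ultimately show ?thesis
      using assms(3,4) by (auto simp: quat_basis_def)
  qed
  then show ?thesis
    unfolding quat_def
    by (intro P.alg_iso_of_indep[OF Q.quat_indep P.quat_indep] Q.quat_basis_mult P.quat_basis_mult)
qed

section \<open>Tensor products of two quaternion algebras inside a ring\<close>

locale biquat = F_algebra s + P: quat_pair s a b i j + Q: quat_pair s c d k l
  for s :: "'a::field \<Rightarrow> 'r::ring_1" and a b i j c d k l +
  assumes ki: "k * i = i * k" and kj: "k * j = j * k" and li: "l * i = i * l" and lj: "l * j = j * l"
begin

definition tensor_basis :: "nat \<Rightarrow> 'r" where
  "tensor_basis p = quat_basis i j (p div 4) * quat_basis k l (p mod 4)"

definition B :: "'r set" where "B = range (lin 16 tensor_basis)"

lemma basis_commute: "quat_basis i j p * quat_basis k l q = quat_basis k l q * quat_basis i j p"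
  by (intro Q.quat_basis_commute P.quat_basis_commute[symmetric]) (simp_all add: ki kj li lj)

lemma prod_lin: "lin 4 (quat_basis i j) X * lin 4 (quat_basis k l) Y
    = lin 16 tensor_basis (\<lambda>p. X (p div 4) * Y (p mod 4))"
  using lin_prod[of 4 4 "quat_basis i j" X "quat_basis k l" Y] by (simp add: tensor_basis_def[abs_def])

lemma tensor_basis_mult:
  assumes "p < 16" "q < 16"
  shows "tensor_basis p * tensor_basis q = lin 16 tensor_basis (snd (alg_tensor (quat a b) (quat c d)) p q)"
proof -
  have dm: "p div 4 < 4" "q div 4 < 4" "p mod 4 < 4" "q mod 4 < 4" using assms by auto
  have "tensor_basis p * tensor_basis q = (quat_basis i j (p div 4) * quat_basis i j (q div 4))
      * (quat_basis k l (p mod 4) * quat_basis k l (q mod 4))"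
    unfolding tensor_basis_def
    by (simp only: mult.assoc) (simp only: mult.assoc[symmetric] basis_commute[symmetric])
  also have "\<dots> = lin 16 tensor_basis (snd (alg_tensor (quat a b) (quat c d)) p q)"
    using dm by (simp add: P.quat_basis_mult Q.quat_basis_mult prod_lin alg_tensor_def quat_def)
  finally show ?thesis .
qed

lemma lin_tensor_basis: "lin 16 tensor_basis X = (\<Sum>p<4. quat_basis i j p * lin 4 (quat_basis k l) (\<lambda>q. X (4 * p + q)))"
proof -
  have "lin 16 tensor_basis X = (\<Sum>p<4*4. s (X (4 * (p div 4) + p mod 4)) * tensor_basis p)"
    by (simp add: lin_def)
  also have "\<dots> = (\<Sum>p<4. \<Sum>q<4. s (X (4 * p + q)) * (quat_basis i j p * quat_basis k l q))"
    unfolding tensor_basis_def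
    by (rule sum_lessThan_mult[of 4 "\<lambda>p q. s (X (4 * p + q)) * (quat_basis i j p * quat_basis k l q)" 4]) simp
  also have "\<dots> = (\<Sum>p<4. quat_basis i j p * lin 4 (quat_basis k l) (\<lambda>q. X (4 * p + q)))"
    by (simp add: lin_def sum_distrib_left s_left)
  finally show ?thesis .
qed

text \<open>\<open>coeff_central\<close> is applied twice: commuting with i and j leaves only a
  coefficient from the second factor, and commuting with k and l leaves only a scalar of
  that.\<close>

lemma center:
  assumes x: "x \<in> B" and comm: "x * i = i * x" "x * j = j * x" "x * k = k * x" "x * l = l * x"
  shows "\<exists>r. x = s r"
proof -
  from x obtain X where X: "x = lin 16 tensor_basis X" by (auto simp: B_def)
  define y where "y p = lin 4 (quat_basis k l) (\<lambda>q. X (4 * p + q))" for p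
  have 1: "x = y 0 + i * y 1 + j * y 2 + i * j * y 3"
    unfolding X lin_tensor_basis sum_lessThan_4 y_def[symmetric] by simp
  have y_comm: "y p * i = i * y p" "y p * j = j * y p" for p
    unfolding y_def by (intro lin_commute[symmetric] Q.quat_basis_commute; simp add: ki kj li lj)+
  have "y 1 = 0" "y 2 = 0" "y 3 = 0"
    by (rule P.coeff_central[OF 1 comm(1,2)]; use y_comm in blast)+
  with 1 have "x = lin 4 (quat_basis k l) X" by (simp add: y_def)
  then have 2: "x = s (X 0) + k * s (X 1) + l * s (X 2) + k * l * s (X 3)"
    by (simp add: lin_4 Q.s_ij s_central[of "k * l"])
  have "s (X 1) = 0" "s (X 2) = 0" "s (X 3) = 0"
    by (rule Q.coeff_central[OF 2 comm(3,4)]; auto simp: Q.s_ij)+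
  with 2 show ?thesis by auto
qed

lemma tensor_basis_indep: "indep 16 tensor_basis"
  unfolding indep_def
proof (intro allI impI)
  fix X :: "nat \<Rightarrow> 'a" and r :: nat assume X: "lin 16 tensor_basis X = 0" and r: "r < 16"
  define x where "x p = lin 4 (quat_basis k l) (\<lambda>q. X (4 * p + q))" for p
  have 0: "x 0 + i * x 1 + j * x 2 + i * j * x 3 = 0"
    using X unfolding lin_tensor_basis sum_lessThan_4 x_def[symmetric] by simp
  have comm: "x p * i = i * x p" "x p * j = j * x p" for p
    unfolding x_def by (intro lin_commute[symmetric] Q.quat_basis_commute; simp add: ki kj li lj)+
  have "x 0 = 0" "x 1 = 0" "x 2 = 0" "x 3 = 0"
    by (rule P.coeff_zero[OF 0]; use comm in blast)+
  moreover have "r div 4 < 4" using r by simp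
  ultimately have "x (r div 4) = 0" unfolding less_4_iff by metis
  then have "X (4 * (r div 4) + r mod 4) = 0"
    unfolding x_def by (intro Q.quat_indep[unfolded indep_def, rule_format, where p = "r mod 4"]) simp_all
  then show "X r = 0" by simp
qed

lemma B_add: "x \<in> B \<Longrightarrow> y \<in> B \<Longrightarrow> x + y \<in> B"
  by (auto simp: B_def lin_add)

lemma B_scale: "x \<in> B \<Longrightarrow> s r * x \<in> B"
  by (auto simp: B_def lin_scale)

lemma B_mult: "x \<in> B \<Longrightarrow> y \<in> B \<Longrightarrow> x * y \<in> B"
  by (auto simp: B_def lin_mult[OF tensor_basis_mult])

lemma tensor_basis_in_B: "p < 16 \<Longrightarrow> tensor_basis p \<in> B"
  unfolding B_def by (metis lin_basis rangeI)

lemma gens_in_B: "1 \<in> B" "i \<in> B" "j \<in> B" "k \<in> B" "l \<in> B"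
  using tensor_basis_in_B[of 0] tensor_basis_in_B[of 4] tensor_basis_in_B[of 8] tensor_basis_in_B[of 1] tensor_basis_in_B[of 2] by (simp_all add: tensor_basis_def)

lemma s_in_B: "s r \<in> B"
  using B_scale[OF gens_in_B(1), of r] by simp

text \<open>Products are needed only with one generator on the right, so properties of an
  antiautomorphism have to be checked on i, j, k, l alone.\<close>

lemma B_induct [consumes 1, case_names add scale one mult]:
  assumes "x \<in> B"
    and add: "\<And>x y. x \<in> B \<Longrightarrow> y \<in> B \<Longrightarrow> R x \<Longrightarrow> R y \<Longrightarrow> R (x + y)"
    and scale: "\<And>c x. x \<in> B \<Longrightarrow> R x \<Longrightarrow> R (s c * x)"
    and one: "R 1"
    and mult: "\<And>x g. x \<in> B \<Longrightarrow> R x \<Longrightarrow> g \<in> {i, j, k, l} \<Longrightarrow> R (x * g)"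
  shows "R x"
proof -
  have q1: "R (quat_basis i j p)" "quat_basis i j p \<in> B" for p
    using mult[OF gens_in_B(1) one, of i] mult[OF gens_in_B(1) one, of j] mult[of i j] one
    by (auto simp: quat_basis_def gens_in_B B_mult)
  have q2: "R (x * quat_basis k l p)" if "R x" "x \<in> B" for x p
    using mult[OF that(2,1), of k] mult[OF that(2,1), of l] mult[of "x * k" l] that
    by (auto simp: quat_basis_def gens_in_B B_mult mult.assoc)
  have tensor_basis: "R (tensor_basis p)" for p unfolding tensor_basis_def by (intro q1 q2)
  from assms(1) obtain X where x: "x = lin 16 tensor_basis X" by (auto simp: B_def)
  have "R (\<Sum>p<n. s (X p) * tensor_basis p) \<and> (\<Sum>p<n. s (X p) * tensor_basis p) \<in> B" if "n \<le> 16" for n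
    using that
  proof (induction n)
    case 0
    have "R (s 0 * 1)" "s 0 * 1 \<in> B" by (intro scale one gens_in_B B_scale)+
    then show ?case by (simp add: s_zero)
  next
    case (Suc n)
    then show ?case by (auto intro!: add scale tensor_basis B_add B_scale tensor_basis_in_B)
  qed
  from this[of 16] show ?thesis by (simp add: x lin_def)
qed

end

lemma alg_iso_biquat:
  assumes "biquat s a b i j c d k l" "biquat s a' b' i' j' c' d' k' l'"
    and "{i', j', k', l'} \<subseteq> biquat.B s i j k l"
  shows "alg_iso (alg_tensor (quat a' b') (quat c' d')) (alg_tensor (quat a b) (quat c d))"
proof -
  interpret P: biquat s a b i j c d k l by fact
  interpret Q: biquat s a' b' i' j' c' d' k' l' by fact
  have "Q.tensor_basis p \<in> P.B" for p
    unfolding Q.tensor_basis_def quat_basis_def using assms(3) by (auto intro!: P.B_mult P.gens_in_B(1))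
  then have "Q.tensor_basis p \<in> range (P.lin 16 P.tensor_basis)" for p by (simp add: P.B_def)
  then have "alg_iso (16, snd (alg_tensor (quat a' b') (quat c' d'))) (16, snd (alg_tensor (quat a b) (quat c d)))"
    by (intro P.alg_iso_of_indep[OF Q.tensor_basis_indep P.tensor_basis_indep] Q.tensor_basis_mult P.tensor_basis_mult)
  then show ?thesis by (simp add: alg_tensor_def quat_def)
qed

section \<open>Changes of presentation and the moves of type I and II\<close>

context F_algebra
begin

lemmas char2_simps = add_self_F add_self_left_F power2_eq_square distrib_left distrib_right add_ac mult_ac

text \<open>Clifford relations: u and v act like vectors with squares r A and r A' and polar value
  r, and their normalised product takes the role of i. This is the origin of the pattern [A * A', r
  * A).\<close>

lemma quat_pairI:
  assumes uu: "u * u = s (r * A)" and vv: "v * v = s (r * A')" and vu: "v * u = u * v + s r"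
    and nz: "r \<noteq> 0" "A \<noteq> 0"
  shows "quat_pair s (A * A') (r * A) (s (1 / r) * (u * v)) u"
proof unfold_locales
  have vuz: "v * (u * z) = u * (v * z) + s r * z" for z
    using arg_cong[OF vu, of "\<lambda>x. x * z"] by (simp add: mult.assoc distrib_right)
  have uuz: "u * (u * z) = s (r * A) * z" for z
    using arg_cong[OF uu, of "\<lambda>x. x * z"] by (simp add: mult.assoc)
  note norm = mult.assoc s_left[of u] s_left[of v] s_central[of u] s_central[of v] vuz uuz uu vv vu
    s_s distrib_left distrib_right
  show "s (1 / r) * (u * v) * (s (1 / r) * (u * v)) = s (1 / r) * (u * v) + s (A * A')"
    using nz by (simp add: norm s_mult[symmetric] add_ac mult.commute[of A'])
  show "u * u = s (r * A)" by (rule uu)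
  show "u * (s (1 / r) * (u * v)) = s (1 / r) * (u * v) * u + u"
    using nz by (simp add: norm s_one add_self add.assoc)
  show "r * A \<noteq> 0" using nz by simp
qed

end

context quat_pair
begin

text \<open>The elements of reduced trace 0, which in characteristic 2 include the scalars. Their
  squares are scalars, namely their norms.\<close>

definition pure :: "'a \<Rightarrow> 'a \<Rightarrow> 'a \<Rightarrow> 'r" where
  "pure x y z = s x + s y * j + s z * (i * j)"

lemma pure_square: "pure x y z * pure x y z = s (x\<^sup>2 + b * (y\<^sup>2 + y * z + a * z\<^sup>2))"
  by (simp add: pure_def quat_norm power2_eq_square s_add mult_ac)

lemma pure_anticomm: "pure x y z * pure x' y' z' = pure x' y' z' * pure x y z + s (b * (y * z' + y' * z))"
  by (simp add: pure_def quat_norm s_add mult_ac)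

lemma pure_in_span: "pure x y z \<in> range (lin 4 (quat_basis i j))"
proof
  show "pure x y z = lin 4 (quat_basis i j) (vec4 x 0 y z)"
    by (simp add: lin_4 vec4_def pure_def s_zero)
qed simp

lemma span_mult:
  "x \<in> range (lin 4 (quat_basis i j)) \<Longrightarrow> y \<in> range (lin 4 (quat_basis i j)) \<Longrightarrow>
   x * y \<in> range (lin 4 (quat_basis i j))"
  by (auto simp: lin_mult[OF quat_basis_mult])

lemma alg_iso_pure:
  assumes r: "r \<noteq> 0" and A: "A = (x\<^sup>2 + b * (y\<^sup>2 + y * z + a * z\<^sup>2)) / r" "A \<noteq> 0"
    and A': "A' = (x'\<^sup>2 + b * (y'\<^sup>2 + y' * z' + a * z'\<^sup>2)) / r"
    and B: "b * (y * z' + y' * z) = r"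
  shows "alg_iso (quat (A * A') (r * A)) (quat a b)"
proof -
  let ?u = "pure x y z" and ?v = "pure x' y' z'"
  have "quat_pair s (A * A') (r * A) (s (1 / r) * (?u * ?v)) ?u"
  proof (rule quat_pairI)
    show "?u * ?u = s (r * A)" using r by (simp add: pure_square A(1))
    show "?v * ?v = s (r * A')" using r by (simp add: pure_square A')
    show "?v * ?u = ?u * ?v + s r"
      unfolding pure_anticomm[of x' y' z'] using B by (simp add: add_ac mult_ac)
  qed fact+
  moreover have "s (1 / r) * (?u * ?v) \<in> range (lin 4 (quat_basis i j))"
    using span_mult[OF pure_in_span[of x y z] pure_in_span[of x' y' z']] by (auto simp: lin_scale)
  ultimately show ?thesis
    using alg_iso_quat[OF quat_pair_axioms] pure_in_span[of x y z] by blast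
qed

lemma alg_iso_square:
  assumes "r \<noteq> 0" shows "alg_iso (quat a (b * r\<^sup>2)) (quat a b)"
proof -
  have "quat_pair s a (b * r\<^sup>2) i (s r * j)"
    using assms b_nz by unfold_locales (simp_all add: quat_norm power2_eq_square mult_ac)
  moreover have "i = lin 4 (quat_basis i j) (vec4 0 1 0 0)" "s r * j = lin 4 (quat_basis i j) (vec4 0 0 r 0)"
    by (simp_all add: lin_4 vec4_def s_zero s_one)
  ultimately show ?thesis using alg_iso_quat[OF quat_pair_axioms] by blast
qed

end

context biquat
begin

lemma commz: "k * (i * z) = i * (k * z)" "k * (j * z) = j * (k * z)"
  "l * (i * z) = i * (l * z)" "l * (j * z) = j * (l * z)"
  by (simp_all only: mult.assoc[symmetric] ki kj li lj)

lemmas biquat_norm = P.quat_norm Q.quat_norm ki kj li lj commz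

text \<open>Conjugation by j and conjugation by l both shift i + k by 1, so j l commutes with i + k.
  The new generating pairs are i + k, j and k, j l.\<close>

lemma alg_iso_typeI:
  "alg_iso (alg_tensor (quat (a + c) b) (quat c (b * d))) (alg_tensor (quat a b) (quat c d))"
proof (rule alg_iso_biquat[OF biquat_axioms])
  show "biquat s (a + c) b (i + k) j c (b * d) k (j * l)"
    using P.b_nz Q.b_nz by unfold_locales (simp_all add: biquat_norm s_add mult_ac)
  show "{i + k, j, k, j * l} \<subseteq> B" by (auto intro!: B_add B_mult gens_in_B)
qed

text \<open>The generators i and k stay, while j and l are multiplied by i + k. Moving i + k past j
  adds 1 to it, so (j (i + k))^2 = b ((i + k)^2 + (i + k)) = b (a + c).\<close>

lemma alg_iso_typeII:
  assumes "a + c \<noteq> 0"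
  shows "alg_iso (alg_tensor (quat a (b * (a + c))) (quat c (d * (a + c))))
    (alg_tensor (quat a b) (quat c d))"
proof (rule alg_iso_biquat[OF biquat_axioms])
  have nz: "b * (a + c) \<noteq> 0" "d * (a + c) \<noteq> 0" using P.b_nz Q.b_nz assms by simp_all
  show "biquat s a (b * (a + c)) i (j * (i + k)) c (d * (a + c)) k (l * (i + k))"
    using nz by unfold_locales (simp_all add: biquat_norm s_add mult_ac)
  show "{i, j * (i + k), k, l * (i + k)} \<subseteq> B" by (auto intro!: B_add B_mult gens_in_B)
qed

end

subsection \<open>The regular representation\<close>

type_synonym 'a vec16 = "bool \<Rightarrow> bool \<Rightarrow> bool \<Rightarrow> bool \<Rightarrow> 'a"

definition scl16 :: "'a::field \<Rightarrow> 'a vec16 \<Rightarrow> 'a vec16" where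
  "scl16 c x = (\<lambda>e f g h. c * x e f g h)"

text \<open>A concrete ring in which the relations of \<open>biquat\<close> can be realized for any
  parameters. Composition of maps makes it associative for free.\<close>

typedef (overloaded) 'a::field endo16 =
  "{F :: 'a vec16 \<Rightarrow> 'a vec16. (\<forall>x y. F (x + y) = F x + F y) \<and> (\<forall>c x. F (scl16 c x) = scl16 c (F x))}"
  by (rule exI[of _ id]) simp

setup_lifting type_definition_endo16

instantiation endo16 :: (field) ring_1
begin

lift_definition zero_endo16 :: "'a endo16" is "\<lambda>_. 0"
  by (auto simp: scl16_def fun_eq_iff)
lift_definition one_endo16 :: "'a endo16" is id
  by simp
lift_definition plus_endo16 :: "'a endo16 \<Rightarrow> 'a endo16 \<Rightarrow> 'a endo16" is "\<lambda>F G x. F x + G x"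
  by (auto simp: scl16_def fun_eq_iff distrib_left)
lift_definition uminus_endo16 :: "'a endo16 \<Rightarrow> 'a endo16" is "\<lambda>F x. - F x"
  by (auto simp: scl16_def fun_eq_iff)
lift_definition minus_endo16 :: "'a endo16 \<Rightarrow> 'a endo16 \<Rightarrow> 'a endo16" is "\<lambda>F G x. F x - G x"
  by (auto simp: scl16_def fun_eq_iff right_diff_distrib)
lift_definition times_endo16 :: "'a endo16 \<Rightarrow> 'a endo16 \<Rightarrow> 'a endo16" is "\<lambda>F G x. F (G x)"
  by simp

instance
proof
  show "(0::'a endo16) \<noteq> 1"
  proof (transfer, rule notI)
    assume "(\<lambda>_. 0) = (id :: 'a vec16 \<Rightarrow> 'a vec16)"
    from fun_cong[OF this, of "\<lambda>_ _ _ _. 1"] show False by (simp add: fun_eq_iff)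
  qed
qed (transfer; auto simp: fun_eq_iff)+

end

lift_definition scalar16 :: "'a::field \<Rightarrow> 'a endo16" is scl16
  by (auto simp: scl16_def fun_eq_iff distrib_left)

text \<open>Left multiplication by i in coordinates for the basis i^e j^f k^g l^h; the next three
  are left multiplication by j, k and l.\<close>

lift_definition i16 :: "'a::field \<Rightarrow> 'a endo16" is
  "\<lambda>a x e f g h. if e then x False f g h + x True f g h else a * x True f g h"
  by (auto simp: scl16_def fun_eq_iff distrib_left)

lift_definition j16 :: "'a::field \<Rightarrow> 'a endo16" is
  "\<lambda>b x e f g h. (if f then 1 else b) *
     (if e then x True (\<not> f) g h else x False (\<not> f) g h + x True (\<not> f) g h)"
  by (auto simp: scl16_def fun_eq_iff distrib_left)

lift_definition k16 :: "'a::field \<Rightarrow> 'a endo16" is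
  "\<lambda>c x e f g h. if g then x e f False h + x e f True h else c * x e f True h"
  by (auto simp: scl16_def fun_eq_iff distrib_left)

lift_definition l16 :: "'a::field \<Rightarrow> 'a endo16" is
  "\<lambda>d x e f g h. (if h then 1 else d) *
     (if g then x e f True (\<not> h) else x e f False (\<not> h) + x e f True (\<not> h))"
  by (auto simp: scl16_def fun_eq_iff distrib_left)

lemma F_algebra_16:
  assumes "(1::'a::field) + 1 = 0" shows "F_algebra (scalar16 :: 'a \<Rightarrow> 'a endo16)"
proof
  show "(1::'a) + 1 = 0" by fact
qed (transfer; auto simp: scl16_def fun_eq_iff distrib_right)+

lemma biquat_16:
  assumes 2: "(1::'a::field) + 1 = 0" and "b \<noteq> 0" "d \<noteq> 0"
  shows "biquat scalar16 (a::'a) b (i16 a) (j16 b) c d (k16 c) (l16 d)"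
proof -
  interpret F_algebra "scalar16 :: 'a \<Rightarrow> 'a endo16" by (rule F_algebra_16[OF 2])
  have F: "x + (x + y) = y" "x + x = 0" for x y :: 'a
    by (rule add_self_left_F add_self_F)+
  show ?thesis
  proof unfold_locales
    show "b \<noteq> 0" "d \<noteq> 0" by fact+
  qed (transfer; auto simp: scl16_def fun_eq_iff algebra_simps F)+
qed

text \<open>The form r x^2 + \<alpha> y^2 + y z + \<beta> z^2 is 1/r times the norm on the
  trace-zero elements of [\<alpha> * \<beta>, r * \<alpha>), so \<open>alg_iso_pure\<close> applies
  to any two of its vectors with polar value 1.\<close>

lemma alg_iso_ternary:
  fixes r \<alpha> \<beta> :: "'a::field"
  assumes 2: "(1::'a) + 1 = 0" and nz: "r \<noteq> 0" "\<alpha> \<noteq> 0" "A \<noteq> 0"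
    and A: "A = x\<^sup>2 * r + y\<^sup>2 * \<alpha> + y * z + z\<^sup>2 * \<beta>"
    and A': "A' = x'\<^sup>2 * r + y'\<^sup>2 * \<alpha> + y' * z' + z'\<^sup>2 * \<beta>"
    and B: "y * z' + y' * z = 1"
  shows "alg_iso (quat (A * A') (r * A)) (quat (\<alpha> * \<beta>) (r * \<alpha>))"
proof -
  interpret biquat scalar16 "\<alpha> * \<beta>" "r * \<alpha>" "i16 (\<alpha> * \<beta>)" "j16 (r * \<alpha>)" 0 1 "k16 0" "l16 1"
    by (rule biquat_16) (use 2 nz in auto)
  \<comment> \<open>With z = \<alpha> w, the trace-zero element of coordinates x r, y + w, w has
    norm r times the ternary form.\<close>
  define w where "w = z / \<alpha>"
  define w' where "w' = z' / \<alpha>"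
  have z: "z = \<alpha> * w" "z' = \<alpha> * w'" using nz by (simp_all add: w_def w'_def)
  show ?thesis
  proof (rule P.alg_iso_pure)
    show "A = ((x * r)\<^sup>2 + r * \<alpha> * ((y + w)\<^sup>2 + (y + w) * w + \<alpha> * \<beta> * w\<^sup>2)) / r"
      unfolding A using nz by (simp add: z eq_divide_eq char2_simps)
    show "A' = ((x' * r)\<^sup>2 + r * \<alpha> * ((y' + w')\<^sup>2 + (y' + w') * w' + \<alpha> * \<beta> * w'\<^sup>2)) / r"
      unfolding A' using nz by (simp add: z eq_divide_eq char2_simps)
    have "r * \<alpha> * ((y + w) * w' + (y' + w') * w) = r * (y * z' + y' * z)"
      by (simp add: z char2_simps)
    then show "r * \<alpha> * ((y + w) * w' + (y' + w') * w) = r" by (simp add: B)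
  qed fact+
qed

lemma alg_iso_quat_square:
  fixes a b :: "'a::field"
  assumes "(1::'a) + 1 = 0" "b \<noteq> 0" "r \<noteq> 0"
  shows "alg_iso (quat a (b * r\<^sup>2)) (quat a b)"
proof -
  interpret biquat scalar16 a b "i16 a" "j16 b" 0 1 "k16 0" "l16 1"
    by (rule biquat_16) (use assms in auto)
  show ?thesis by (rule P.alg_iso_square) fact
qed

lemma alg_iso_tensor_typeI:
  fixes a b c d :: "'a::field"
  assumes "(1::'a) + 1 = 0" "b \<noteq> 0" "d \<noteq> 0"
  shows "alg_iso (alg_tensor (quat a b) (quat c d)) (alg_tensor (quat (a + c) b) (quat c (b * d)))"
proof -
  interpret biquat scalar16 a b "i16 a" "j16 b" c d "k16 c" "l16 d"
    by (rule biquat_16) fact+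
  show ?thesis by (rule alg_iso_sym) (rule alg_iso_typeI)
qed

lemma alg_iso_tensor_typeII:
  fixes a b c d :: "'a::field"
  assumes "(1::'a) + 1 = 0" "b \<noteq> 0" "d \<noteq> 0" "a + c \<noteq> 0"
  shows "alg_iso (alg_tensor (quat a b) (quat c d))
    (alg_tensor (quat a (b * (a + c))) (quat c (d * (a + c))))"
proof -
  interpret biquat scalar16 a b "i16 a" "j16 b" c d "k16 c" "l16 d"
    by (rule biquat_16) fact+
  show ?thesis by (rule alg_iso_sym) (rule alg_iso_typeII, fact)
qed

subsection \<open>Intertwiners\<close>

text \<open>Images of the basis under the canonical involution, which sends i to i + 1 and fixes j;
  it fixes ij as well.\<close>

definition conj_basis :: "'r::ring_1 \<Rightarrow> 'r \<Rightarrow> nat \<Rightarrow> 'r" where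
  "conj_basis i j p = (if p = 0 then 1 else if p = 1 then i + 1 else if p = 2 then j else i * j)"

lemma conj_basis_simps [simp]:
  "conj_basis i j 0 = 1" "conj_basis i j (Suc 0) = i + 1" "conj_basis i j 1 = i + 1"
  "conj_basis i j 2 = j" "conj_basis i j 3 = i * j"
  "conj_basis i j (Suc (Suc 0)) = j" "conj_basis i j (Suc (Suc (Suc 0))) = i * j"
  by (simp_all add: conj_basis_def)

lemma (in quat_pair) conj_basis_mult:
  assumes "p < 4" "q < 4"
  shows "conj_basis i j q * conj_basis i j p = lin 4 (conj_basis i j) (quat_prod a b p q)"
  using assms unfolding less_4_iff
  by (elim disjE; simp only:; simp add: lin_4 quat_prod_def vec4_def s_zero s_one quat_norm mult.commute)

text \<open>A constructive Skolem-Noether argument. \<open>C w\<close> always intertwines j with j';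
  \<open>T\<close> produces an intertwiner of i with i' and preserves intertwining of j. So
  \<open>T (C w)\<close> intertwines both pairs, and only its being nonzero for some w is at stake.
  W is any set stable under the operations, so that the argument can be iterated.\<close>

lemma quat_pair_intertwiner:
  assumes "quat_pair s a b i j" "quat_pair s a b i' j'"
    and add: "\<And>x y. x \<in> W \<Longrightarrow> y \<in> W \<Longrightarrow> x + y \<in> W"
    and right: "\<And>x. x \<in> W \<Longrightarrow> x * i \<in> W" "\<And>x. x \<in> W \<Longrightarrow> x * j \<in> W"
    and left: "\<And>x. x \<in> W \<Longrightarrow> i' * x \<in> W" "\<And>x. x \<in> W \<Longrightarrow> j' * x \<in> W"
    and x: "x \<in> W" "x \<noteq> 0"
  shows "\<exists>w\<in>W. w \<noteq> 0 \<and> i' * w = w * i \<and> j' * w = w * j"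
proof -
  interpret P: quat_pair s a b i j by fact
  interpret P': quat_pair s a b i' j' by fact
  define C where "C w = w * j + j' * w" for w
  define T where "T w = i' * w + w * i + w" for w
  note norm = C_def T_def P.quat_norm P'.quat_norm
  have "\<exists>w\<in>W. T (C w) \<noteq> 0"
  proof (rule ccontr)
    assume "\<not> ?thesis"
    \<comment> \<open>If \<open>T (C w)\<close> vanishes on W, so does \<open>T (w * j)\<close>. But
      \<open>T (w * j) = (T w + w) * j\<close>, hence T is the identity on W, and evaluating at
      \<open>x * j\<close> gives a contradiction.\<close>
    then have 0: "T (C w) = 0" if "w \<in> W" for w using that by blast
    have T: "T (w * j) = 0" if "w \<in> W" for w
    proof -
      have "T (C (w * i)) = T (C w) * i + T (w * j)"
        by (simp add: norm)
      then show ?thesis using 0 right that by simp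
    qed
    have zero: "w = 0" if "w * j = 0" for w
    proof -
      have "s b * w = w * j * j" by (simp add: mult.assoc P.jj P.s_central)
      then show ?thesis using that P.b_nz P.s_cancel by simp
    qed
    have eq: "T w = w" if "w \<in> W" for w
    proof -
      have "(T w + w) * j = T (w * j)" by (simp add: norm)
      then have "T w + w = 0" using T that zero by simp
      then show ?thesis by (simp add: P.add_eq_0)
    qed
    have "x * j = 0" using eq[OF right(2)[OF x(1)]] T[OF x(1)] by simp
    then show False using x zero by blast
  qed
  then obtain w where w: "w \<in> W" "T (C w) \<noteq> 0" by blast
  have "i' * T (C w) = T (C w) * i" "j' * T (C w) = T (C w) * j"
    by (simp_all add: norm P.s_central[of w] P.s_left[of w])
  moreover have "T (C w) \<in> W"
    unfolding C_def T_def by (intro add left right w(1))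
  ultimately show ?thesis using w(2) by blast
qed

text \<open>The intertwiners of the first pairs form a set that is stable under k, l on the right
  and k', l' on the left, because these commute with i, j and i', j'. The quaternion case applies
  again inside that set.\<close>

lemma biquat_intertwiner:
  assumes "biquat s a b i j c d k l" "biquat s a b i' j' c d k' l'"
    and add: "\<And>x y. x \<in> W \<Longrightarrow> y \<in> W \<Longrightarrow> x + y \<in> W"
    and right: "\<And>x g. x \<in> W \<Longrightarrow> g \<in> {i, j, k, l} \<Longrightarrow> x * g \<in> W"
    and left: "\<And>x g. x \<in> W \<Longrightarrow> g \<in> {i', j', k', l'} \<Longrightarrow> g * x \<in> W"
    and x: "x \<in> W" "x \<noteq> 0"
  shows "\<exists>w\<in>W. w \<noteq> 0 \<and> i' * w = w * i \<and> j' * w = w * j \<and> k' * w = w * k \<and> l' * w = w * l"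
proof -
  interpret U: biquat s a b i j c d k l by fact
  interpret U': biquat s a b i' j' c d k' l' by fact
  let ?W = "{w \<in> W. i' * w = w * i \<and> j' * w = w * j}"
  have "\<exists>w\<in>W. w \<noteq> 0 \<and> i' * w = w * i \<and> j' * w = w * j"
    by (rule quat_pair_intertwiner[OF U.P.quat_pair_axioms U'.P.quat_pair_axioms])
      (use add right left x in auto)
  then obtain y where y: "y \<in> ?W" "y \<noteq> 0" by blast
  have "\<exists>w\<in>?W. w \<noteq> 0 \<and> k' * w = w * k \<and> l' * w = w * l"
  proof (rule quat_pair_intertwiner[OF U.Q.quat_pair_axioms U'.Q.quat_pair_axioms _ _ _ _ _ y])
    have z: "i' * (k' * z) = k' * (i' * z)" "j' * (k' * z) = k' * (j' * z)"
      "i' * (l' * z) = l' * (i' * z)" "j' * (l' * z) = l' * (j' * z)" for z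
      by (simp_all only: mult.assoc[symmetric] U'.ki U'.kj U'.li U'.lj)
    show "z * k \<in> ?W" "z * l \<in> ?W" "k' * z \<in> ?W" "l' * z \<in> ?W" if "z \<in> ?W" for z
      using that right left
      by (auto simp: z mult.assoc U.ki U.kj U.li U.lj) (simp_all only: mult.assoc[symmetric])
    show "z + z' \<in> ?W" if "z \<in> ?W" "z' \<in> ?W" for z z'
      using that add by (auto simp: distrib_left distrib_right)
  qed
  then show ?thesis by blast
qed

context biquat
begin

text \<open>Simplicity of B: intertwining the generators with themselves inside a nonzero ideal
  produces a nonzero central element of that ideal.\<close>

lemma ideal_scalar:
  assumes "W \<subseteq> B" and add: "\<And>x y. x \<in> W \<Longrightarrow> y \<in> W \<Longrightarrow> x + y \<in> W"
    and right: "\<And>x y. x \<in> W \<Longrightarrow> y \<in> B \<Longrightarrow> x * y \<in> W"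
    and left: "\<And>x y. x \<in> W \<Longrightarrow> y \<in> B \<Longrightarrow> y * x \<in> W"
    and x: "x \<in> W" "x \<noteq> 0"
  shows "\<exists>r. r \<noteq> 0 \<and> s r \<in> W"
proof -
  have "\<exists>w\<in>W. w \<noteq> 0 \<and> i * w = w * i \<and> j * w = w * j \<and> k * w = w * k \<and> l * w = w * l"
    by (rule biquat_intertwiner[OF biquat_axioms biquat_axioms add _ _ x])
      (use left right gens_in_B in auto)
  then obtain w where w: "w \<in> W" "w \<noteq> 0" "w * i = i * w" "w * j = j * w" "w * k = k * w" "w * l = l * w"
    by auto
  with center[of w] assms(1) obtain r where "w = s r" by blast
  moreover have "r \<noteq> 0" using w(2) calculation s_zero by auto
  ultimately show ?thesis using w(1) by auto
qed

text \<open>The elements w with w B y = 0 form a two-sided ideal; if it is nonzero, it contains a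
  nonzero scalar, which kills y.\<close>

lemma prime_B:
  assumes "x \<in> B" "\<And>z. z \<in> B \<Longrightarrow> x * z * y = 0"
  shows "x = 0 \<or> y = 0"
proof (rule disjCI)
  assume "y \<noteq> 0"
  show "x = 0"
  proof (rule ccontr)
    assume "x \<noteq> 0"
    let ?W = "{w \<in> B. \<forall>z\<in>B. w * z * y = 0}"
    have "\<exists>r. r \<noteq> 0 \<and> s r \<in> ?W"
    proof (rule ideal_scalar)
      show "x \<in> ?W" using assms by blast
      show "w * v \<in> ?W" if w: "w \<in> ?W" and v: "v \<in> B" for v w
      proof -
        have "w * v * z * y = w * (v * z) * y" for z by (simp only: mult.assoc)
        then show ?thesis using w v B_mult by simp
      qed
      show "v * w \<in> ?W" if w: "w \<in> ?W" and v: "v \<in> B" for v w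
      proof -
        have "v * w * z * y = v * (w * z * y)" for z by (simp only: mult.assoc)
        then show ?thesis using w v B_mult by simp
      qed
      show "w + v \<in> ?W" if "w \<in> ?W" "v \<in> ?W" for v w
        using that B_add by (auto simp: distrib_right)
    qed (use \<open>x \<noteq> 0\<close> in auto)
    then obtain r where "r \<noteq> 0" "\<forall>z\<in>B. s r * z * y = 0" by blast
    then have "s r * y = 0" using gens_in_B(1) by fastforce
    with \<open>r \<noteq> 0\<close> \<open>y \<noteq> 0\<close> show False using s_cancel by blast
  qed
qed

subsection \<open>The involution and its symmetrized elements\<close>

definition conj_tensor_basis :: "nat \<Rightarrow> 'r" where
  "conj_tensor_basis p = conj_basis i j (p div 4) * conj_basis k l (p mod 4)"

text \<open>Conjugation in both factors, defined through coordinates; independence of the basis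
  makes the choice immaterial.\<close>

definition \<sigma> :: "'r \<Rightarrow> 'r" where
  "\<sigma> x = lin 16 conj_tensor_basis (SOME X. x = lin 16 tensor_basis X)"

lemma \<sigma>_lin: "\<sigma> (lin 16 tensor_basis X) = lin 16 conj_tensor_basis X"
proof -
  let ?Y = "SOME Y. lin 16 tensor_basis X = lin 16 tensor_basis Y"
  have "lin 16 tensor_basis X = lin 16 tensor_basis ?Y" 
    by (rule someI[of "\<lambda>Y. lin 16 tensor_basis X = lin 16 tensor_basis Y" X]) (rule refl)
  then have "X p = ?Y p" if "p < 16" for p by (rule indepD[OF tensor_basis_indep _ that])
  then have "lin 16 conj_tensor_basis X = lin 16 conj_tensor_basis ?Y" by (rule lin_cong)
  then show ?thesis by (simp only: \<sigma>_def)
qed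

lemma \<sigma>_add: "x \<in> B \<Longrightarrow> y \<in> B \<Longrightarrow> \<sigma> (x + y) = \<sigma> x + \<sigma> y"
  by (auto simp: B_def lin_add \<sigma>_lin)

lemma \<sigma>_scale: "x \<in> B \<Longrightarrow> \<sigma> (s r * x) = s r * \<sigma> x"
  by (auto simp: B_def lin_scale \<sigma>_lin)

lemma \<sigma>_tensor_basis: "p < 16 \<Longrightarrow> \<sigma> (tensor_basis p) = conj_tensor_basis p"
  using \<sigma>_lin[of "\<lambda>k. if k = p then 1 else 0"] by (simp add: lin_basis)

lemma \<sigma>_gens: "\<sigma> 1 = 1" "\<sigma> i = i + 1" "\<sigma> j = j" "\<sigma> k = k + 1" "\<sigma> l = l"
  using \<sigma>_tensor_basis[of 0] \<sigma>_tensor_basis[of 4] \<sigma>_tensor_basis[of 8] \<sigma>_tensor_basis[of 1] \<sigma>_tensor_basis[of 2] by (simp_all add: tensor_basis_def conj_tensor_basis_def)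

lemma conj_basis_commute: "conj_basis i j p * conj_basis k l q = conj_basis k l q * conj_basis i j p"
proof -
  have "x * conj_basis k l q = conj_basis k l q * x" if "x * k = k * x" "x * l = l * x" for x
    using that unfolding conj_basis_def
    by (auto simp: distrib_left distrib_right) (metis mult.assoc)
  moreover have "conj_basis i j p * x = x * conj_basis i j p" if "i * x = x * i" "j * x = x * j" for x
    using that unfolding conj_basis_def
    by (auto simp: distrib_left distrib_right) (metis mult.assoc)
  ultimately show ?thesis by (simp add: ki kj li lj)
qed

lemma conj_tensor_basis_mult:
  assumes "p < 16" "q < 16"
  shows "conj_tensor_basis q * conj_tensor_basis p = lin 16 conj_tensor_basis (snd (alg_tensor (quat a b) (quat c d)) p q)"
proof -
  have dm: "p div 4 < 4" "q div 4 < 4" "p mod 4 < 4" "q mod 4 < 4" using assms by auto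
  have prod: "lin 4 (conj_basis i j) X * lin 4 (conj_basis k l) Y
      = lin 16 conj_tensor_basis (\<lambda>p. X (p div 4) * Y (p mod 4))" for X Y
    using lin_prod[of 4 4 "conj_basis i j" X "conj_basis k l" Y] by (simp add: conj_tensor_basis_def[abs_def])
  have "conj_tensor_basis q * conj_tensor_basis p = (conj_basis i j (q div 4) * conj_basis i j (p div 4))
      * (conj_basis k l (q mod 4) * conj_basis k l (p mod 4))"
    unfolding conj_tensor_basis_def
    by (simp only: mult.assoc) (simp only: mult.assoc[symmetric] conj_basis_commute[symmetric])
  also have "\<dots> = lin 16 conj_tensor_basis (snd (alg_tensor (quat a b) (quat c d)) p q)"
    using dm by (simp add: P.conj_basis_mult Q.conj_basis_mult prod alg_tensor_def quat_def)
  finally show ?thesis .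
qed

text \<open>The conjugated basis multiplies in reverse order with the structure constants of the
  original basis.\<close>

lemma \<sigma>_mult:
  assumes "x \<in> B" "y \<in> B" shows "\<sigma> (x * y) = \<sigma> y * \<sigma> x"
proof -
  from assms obtain X Y where x: "x = lin 16 tensor_basis X" and y: "y = lin 16 tensor_basis Y" by (auto simp: B_def)
  let ?sc = "snd (alg_tensor (quat a b) (quat c d))"
  have "\<sigma> y * \<sigma> x = lin 16 conj_tensor_basis (\<lambda>k. \<Sum>q<16. \<Sum>p<16. Y q * X p * ?sc p q k)"
    unfolding x y \<sigma>_lin by (rule lin_mult) (rule conj_tensor_basis_mult)
  also have "(\<lambda>k. \<Sum>q<16. \<Sum>p<16. Y q * X p * ?sc p q k) = (\<lambda>k. \<Sum>p<16. \<Sum>q<16. X p * Y q * ?sc p q k)"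
    by (subst sum.swap) (simp only: mult.commute)
  finally have "\<sigma> y * \<sigma> x = lin 16 conj_tensor_basis (\<lambda>k. \<Sum>p<16. \<Sum>q<16. X p * Y q * ?sc p q k)" .
  moreover have "x * y = lin 16 tensor_basis (\<lambda>k. \<Sum>p<16. \<Sum>q<16. X p * Y q * ?sc p q k)"
    unfolding x y by (rule lin_mult) (rule tensor_basis_mult)
  ultimately show ?thesis by (simp only: \<sigma>_lin)
qed

lemma \<sigma>_in_B: "x \<in> B \<Longrightarrow> \<sigma> x \<in> B"
proof (induction rule: B_induct)
  case (mult x g)
  then show ?case by (auto simp: \<sigma>_mult \<sigma>_gens gens_in_B intro!: B_mult B_add)
qed (auto simp: \<sigma>_add \<sigma>_scale \<sigma>_gens intro!: B_add B_scale gens_in_B)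

lemma \<sigma>_\<sigma>: "x \<in> B \<Longrightarrow> \<sigma> (\<sigma> x) = x"
proof (induction rule: B_induct)
  case (mult x g)
  then have "\<sigma> (\<sigma> g) = g" "g \<in> B"
    by (auto simp: \<sigma>_gens \<sigma>_add gens_in_B add.assoc add_self)
  with mult show ?case by (auto simp: \<sigma>_mult \<sigma>_in_B)
qed (auto simp: \<sigma>_add \<sigma>_scale \<sigma>_gens \<sigma>_in_B)

end

section \<open>The Albert form on the symmetrized elements\<close>

type_synonym 'a vec6 = "'a \<times> 'a \<times> 'a \<times> 'a \<times> 'a \<times> 'a"

definition scl6 :: "'a::field \<Rightarrow> 'a vec6 \<Rightarrow> 'a vec6" where
  "scl6 c = (\<lambda>(x0, x1, x2, x3, x4, x5). (c * x0, c * x1, c * x2, c * x3, c * x4, c * x5))"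

text \<open>The reduced Pfaffian norm of the symplectic involution that is the tensor product of the two
  canonical involutions of [a,b) and [c,d).\<close>

definition albert :: "'a::field \<Rightarrow> 'a \<Rightarrow> 'a \<Rightarrow> 'a \<Rightarrow> 'a vec6 \<Rightarrow> 'a" where
  "albert a b c d = (\<lambda>(x0, x1, x2, x3, x4, x5). x0\<^sup>2 + x0 * x1 + (a + c) * x1\<^sup>2
     + b * (x2\<^sup>2 + x2 * x3 + a * x3\<^sup>2) + d * (x4\<^sup>2 + x4 * x5 + c * x5\<^sup>2))"

definition tr6 :: "'a::field vec6 \<Rightarrow> 'a" where "tr6 x = fst (snd x)"

context biquat
begin

definition emb :: "'a vec6 \<Rightarrow> 'r" where
  "emb = (\<lambda>(x0, x1, x2, x3, x4, x5). s x0 + s x1 * (i + k) + s x2 * j + s x3 * (i * j)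
     + s x4 * l + s x5 * (k * l))"

lemma emb_add: "emb (x + y) = emb x + emb y"
  by (cases x; cases y) (simp add: emb_def s_add distrib_left distrib_right add_ac)

lemma emb_scl: "emb (scl6 r x) = s r * emb x"
  by (cases x) (simp add: emb_def scl6_def s_mult distrib_left mult.assoc)

lemma emb_scalar: "emb (r, 0, 0, 0, 0, 0) = s r"
  by (simp add: emb_def s_zero)

lemma emb_in_B: "emb x \<in> B"
  by (cases x) (auto simp: emb_def intro!: B_add B_scale B_mult gens_in_B s_in_B)

lemma lin_16: "lin 16 h X = (\<Sum>p<4. \<Sum>q<4. s (X (4 * p + q)) * h (4 * p + q))"
  using sum_lessThan_mult[of 4 "\<lambda>p q. s (X (4 * p + q)) * h (4 * p + q)" 4] by (simp add: lin_def)

lemma emb_eq_0: "emb x = 0 \<longleftrightarrow> x = 0"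
proof
  assume 0: "emb x = 0"
  obtain x0 x1 x2 x3 x4 x5 where x: "x = (x0, x1, x2, x3, x4, x5)" by (cases x)
  define X where "X p = (if p = 0 then x0 else if p = 1 \<or> p = 4 then x1 else if p = 2 then x4
      else if p = 3 then x5 else if p = 8 then x2 else if p = 12 then x3 else 0)" for p :: nat
  have "emb x = lin 16 tensor_basis X"
    unfolding lin_16 sum_lessThan_4
    by (simp add: x emb_def X_def tensor_basis_def s_zero distrib_left add_ac)
  with 0 have "X p = 0" if "p < 16" for p using that tensor_basis_indep unfolding indep_def by simp
  from this[of 0] this[of 1] this[of 8] this[of 12] this[of 2] this[of 3]
  show "x = 0" by (simp add: X_def x zero_prod_def)
qed (simp add: emb_def zero_prod_def s_zero)

lemma emb_inj: "emb x = emb y \<Longrightarrow> x = y"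
proof -
  assume "emb x = emb y"
  then have "emb (x - y) + emb y = 0 + emb y"
    by (simp flip: emb_add)
  then have "emb (x - y) = 0" by simp
  then show "x = y" by (simp add: emb_eq_0)
qed

text \<open>The basis index is 4 times the first index plus the second. Only k, i, ik, jk, ijk, il,
  ikl have nonzero symmetrizations, namely 1, 1, 1 + i + k, j, ij, l, kl.\<close>

lemma symd_lin: "lin 16 tensor_basis X + \<sigma> (lin 16 tensor_basis X) = emb (X 1 + X 4 + X 5, X 5, X 9, X 13, X 6, X 7)"
  unfolding \<sigma>_lin unfolding lin_16 sum_lessThan_4
  by (simp add: emb_def tensor_basis_def conj_tensor_basis_def s_add biquat_norm)

lemma symd_emb: "x \<in> B \<Longrightarrow> \<exists>t. x + \<sigma> x = emb t"
  unfolding B_def using symd_lin by blast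

lemma emb_symd: "\<exists>x\<in>B. emb t = x + \<sigma> x"
proof -
  obtain x0 x1 x2 x3 x4 x5 where t: "t = (x0, x1, x2, x3, x4, x5)" by (cases t)
  \<comment> \<open>A solution of \<open>symd_lin\<close>: the coefficient x1 at ik also adds x1 to
    the scalar part, which the coefficient at k cancels.\<close>
  define X where "X p = (if p = 1 then x0 + x1 else if p = 5 then x1 else if p = 6 then x4
      else if p = 7 then x5 else if p = 9 then x2 else if p = 13 then x3 else 0)" for p :: nat
  have "emb t = lin 16 tensor_basis X + \<sigma> (lin 16 tensor_basis X)"
    unfolding symd_lin by (simp add: t X_def add_self_F add.assoc)
  then show ?thesis by (auto simp: B_def)
qed

lemma emb_square: "emb x * emb x = s (tr6 x) * emb x + s (albert a b c d x)"
  by (cases x)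
    (simp add: emb_def tr6_def albert_def biquat_norm s_add power2_eq_square mult_ac)

text \<open>The second root of the quadratic equation of \<open>emb x\<close>; divided by the Albert
  value, if nonzero, it is the inverse of \<open>emb x\<close>.\<close>

definition cemb :: "'a vec6 \<Rightarrow> 'r" where "cemb x = emb x + s (tr6 x)"

lemma emb_cemb: "emb x * cemb x = s (albert a b c d x)" "cemb x * emb x = s (albert a b c d x)"
  by (simp_all add: cemb_def distrib_left distrib_right emb_square s_central[of "emb x"] add_self_left
      add_self add.assoc add.left_commute add.commute)

lemma cemb_add: "cemb (x + y) = cemb x + cemb y"
  by (simp add: cemb_def emb_add tr6_def s_add add_ac)

lemma cemb_eq_0: "cemb x = 0 \<longleftrightarrow> x = 0"
proof
  assume 0: "cemb x = 0"
  have "cemb x = emb (x + (tr6 x, 0, 0, 0, 0, 0))"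
    by (simp add: cemb_def emb_add emb_scalar)
  with 0 have x: "x + (tr6 x, 0, 0, 0, 0, 0) = 0" by (simp add: emb_eq_0)
  then have "tr6 x = 0" by (cases x) (simp add: tr6_def zero_prod_def)
  with x show "x = 0" by (cases x) (simp add: zero_prod_def)
qed (simp add: cemb_def emb_eq_0[THEN iffD2] tr6_def s_zero)

end

section \<open>Two decompositions of one algebra have similar Albert forms\<close>

lemma (in F_algebra) add_exchange:
  assumes "(p::'r) + q = u + v" shows "p + u = q + v"
proof -
  have "p + u = (p + q) + (q + u)" by (simp add: add_ac add_self_left)
  also have "\<dots> = (u + v) + (q + u)" by (simp only: assms)
  also have "\<dots> = q + v" by (simp add: add_ac add_self_left add_self)
  finally show ?thesis .
qed

text \<open>The intertwiner satisfies \<open>w * ?\<tau> x = ?\<sigma> x * w\<close>, so w (x +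
  \<tau> x) = w x + \<sigma> (w x): left multiplication by w carries symmetrized elements to
  symmetrized elements. The similitude property comes from comparing two quadratic equations for one
  element.\<close>

lemma albert_similar:
  assumes "biquat s a b i j c d k l" "biquat s a' b' i' j' c' d' k' l'"
    and B_eq: "biquat.B s i' j' k' l' = biquat.B s i j k l"
  obtains g r where "bij g" "\<And>x y. g (x + y) = g x + g y" "\<And>e x. g (scl6 e x) = scl6 e (g x)"
    "r \<noteq> 0" "\<And>x. albert a b c d (g x) = r * albert a' b' c' d' x"
proof -
  interpret U: biquat s a b i j c d k l by fact
  interpret V: biquat s a' b' i' j' c' d' k' l' by fact
  let ?B = U.B and ?\<sigma> = U.\<sigma> and ?\<tau> = V.\<sigma>
  have gens: "i' \<in> ?B" "j' \<in> ?B" "k' \<in> ?B" "l' \<in> ?B"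
    using V.gens_in_B unfolding B_eq by auto
  \<comment> \<open>Images of i', j', k', l' under \<sigma> composed with \<tau>. Two
    antiautomorphisms compose to an automorphism, so these elements satisfy the same
    relations.\<close>
  define I J K L where "I = ?\<sigma> i' + 1" and "J = ?\<sigma> j'" and "K = ?\<sigma> k' + 1" and "L = ?\<sigma> l'"
  have \<sigma>_s: "?\<sigma> (s r) = s r" for r
    using U.\<sigma>_scale[OF U.gens_in_B(1), of r] by (simp add: U.\<sigma>_gens)
  have quat: "quat_pair s e f (?\<sigma> m + 1) (?\<sigma> n)"
    if "quat_pair s e f m n" and mn: "m \<in> ?B" "n \<in> ?B" for e f m n
  proof -
    interpret T: quat_pair s e f m n by fact
    have 1: "?\<sigma> m * ?\<sigma> m = ?\<sigma> m + s e"
      using arg_cong[OF T.ii, of ?\<sigma>] mn by (simp add: U.\<sigma>_mult U.\<sigma>_add U.s_in_B \<sigma>_s)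
    have 2: "?\<sigma> n * ?\<sigma> n = s f"
      using arg_cong[OF T.jj, of ?\<sigma>] mn by (simp add: U.\<sigma>_mult U.s_in_B \<sigma>_s)
    have "?\<sigma> m * ?\<sigma> n = ?\<sigma> n * ?\<sigma> m + ?\<sigma> n"
      using arg_cong[OF T.ji, of ?\<sigma>] mn by (simp add: U.\<sigma>_mult U.\<sigma>_add U.B_mult)
    then have 3: "?\<sigma> n * (?\<sigma> m + 1) = (?\<sigma> m + 1) * ?\<sigma> n + ?\<sigma> n"
      by (simp add: distrib_left distrib_right U.add_self_left U.add_self add.assoc)
    show ?thesis
      by unfold_locales
        (use T.b_nz 2 3 in \<open>simp_all add: 1 distrib_left distrib_right add_ac U.add_self U.add_self_left\<close>)
  qed
  have comm: "?\<sigma> m * ?\<sigma> n = ?\<sigma> n * ?\<sigma> m" if "m * n = n * m" "m \<in> ?B" "n \<in> ?B" for m n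
    using arg_cong[OF that(1), of ?\<sigma>] that(2,3) by (simp add: U.\<sigma>_mult)
  have "biquat s a' b' I J c' d' K L"
  proof -
    interpret T1: quat_pair s a' b' I J
      unfolding I_def J_def by (rule quat[OF V.P.quat_pair_axioms gens(1,2)])
    interpret T2: quat_pair s c' d' K L
      unfolding K_def L_def by (rule quat[OF V.Q.quat_pair_axioms gens(3,4)])
    show ?thesis
      by unfold_locales
        (simp_all add: I_def J_def K_def L_def distrib_left distrib_right add_ac
          comm[OF V.ki gens(3,1)] comm[OF V.kj gens(3,2)] comm[OF V.li gens(4,1)] comm[OF V.lj gens(4,2)])
  qed
  moreover have IB: "I \<in> ?B" "J \<in> ?B" "K \<in> ?B" "L \<in> ?B"
    unfolding I_def J_def K_def L_def by (intro U.B_add U.\<sigma>_in_B U.gens_in_B gens)+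
  ultimately have "\<exists>w\<in>?B. w \<noteq> 0 \<and> I * w = w * i' \<and> J * w = w * j' \<and> K * w = w * k' \<and> L * w = w * l'"
    by (intro biquat_intertwiner[OF V.biquat_axioms _ _ _ _ U.gens_in_B(1)])
      (auto intro: U.B_add U.B_mult gens)
  then obtain w0 where w0: "w0 \<in> ?B" "w0 \<noteq> 0" "I * w0 = w0 * i'" "J * w0 = w0 * j'"
    "K * w0 = w0 * k'" "L * w0 = w0 * l'" by blast
  have \<sigma>w0: "I * ?\<sigma> w0 = ?\<sigma> w0 * i'" "J * ?\<sigma> w0 = ?\<sigma> w0 * j'"
    "K * ?\<sigma> w0 = ?\<sigma> w0 * k'" "L * ?\<sigma> w0 = ?\<sigma> w0 * l'"
  proof -
    have *: "(?\<sigma> m + 1) * ?\<sigma> w0 = ?\<sigma> w0 * m" if "(?\<sigma> m + 1) * w0 = w0 * m" "m \<in> ?B" for m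
    proof -
      have "?\<sigma> w0 * (m + 1) = ?\<sigma> m * ?\<sigma> w0"
        using arg_cong[OF that(1), of ?\<sigma>] that(2) w0(1)
        by (simp add: U.\<sigma>_mult U.\<sigma>_add U.\<sigma>_in_B U.B_add U.gens_in_B U.\<sigma>_\<sigma> U.\<sigma>_gens)
      then show ?thesis
        by (metis (no_types, lifting) U.add_self_left add.commute distrib_left distrib_right mult.right_neutral mult_1)
    qed
    have **: "?\<sigma> m * ?\<sigma> w0 = ?\<sigma> w0 * m" if "?\<sigma> m * w0 = w0 * m" "m \<in> ?B" for m
      using arg_cong[OF that(1), of ?\<sigma>] that(2) w0(1)
      by (simp add: U.\<sigma>_mult U.\<sigma>_in_B U.\<sigma>_\<sigma>)
    show "I * ?\<sigma> w0 = ?\<sigma> w0 * i'" "J * ?\<sigma> w0 = ?\<sigma> w0 * j'"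
      "K * ?\<sigma> w0 = ?\<sigma> w0 * k'" "L * ?\<sigma> w0 = ?\<sigma> w0 * l'"
      using w0 gens unfolding I_def J_def K_def L_def by (auto intro: * **)
  qed
  \<comment> \<open>If w0 is symmetric it is already symmetrized, because w0 = w0 * i' + \<sigma> (w0 * i').\<close>
  define w where "w = (if ?\<sigma> w0 = w0 then w0 else w0 + ?\<sigma> w0)"
  have w: "w \<in> ?B" "w \<noteq> 0" "?\<sigma> w = w"
    using w0(1,2) U.add_eq_0[of w0 "?\<sigma> w0"]
    by (auto simp: w_def U.\<sigma>_add U.\<sigma>_in_B U.\<sigma>_\<sigma> add.commute intro: U.B_add)
  have wI: "I * w = w * i'" "J * w = w * j'" "K * w = w * k'" "L * w = w * l'"
    using w0 \<sigma>w0 by (auto simp: w_def distrib_left distrib_right)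
  have w_\<tau>: "w * ?\<tau> x = ?\<sigma> x * w" if "x \<in> ?B" for x
    using that unfolding B_eq[symmetric]
  proof (induction rule: V.B_induct)
    case (add x y)
    then show ?case unfolding V.\<sigma>_add[OF add.hyps] U.\<sigma>_add[OF add.hyps[unfolded B_eq]]
      using add.IH by (simp add: distrib_left distrib_right)
  next
    case (scale e x)
    then show ?case unfolding V.\<sigma>_scale[OF scale.hyps] U.\<sigma>_scale[OF scale.hyps[unfolded B_eq]]
      using scale.IH by (simp add: U.s_left[of w] mult.assoc)
  next
    case (mult x g)
    have gB: "g \<in> V.B" using mult.hyps(2) V.gens_in_B by auto
    have g: "w * ?\<tau> g = ?\<sigma> g * w"
      using mult.hyps(2) wI by (auto simp: V.\<sigma>_gens I_def J_def K_def L_def distrib_left distrib_right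
          U.add_self_left U.add_self add.assoc wI[symmetric])
    show ?case
      unfolding V.\<sigma>_mult[OF mult.hyps(1) gB] U.\<sigma>_mult[OF mult.hyps(1)[unfolded B_eq] gB[unfolded B_eq]]
      by (metis g mult.IH mult.assoc)
  qed (simp add: V.\<sigma>_gens U.\<sigma>_gens)
  have "w = w * i' + ?\<sigma> (w * i')"
  proof -
    have 1: "?\<sigma> (w * i') = ?\<sigma> i' * w" using w gens by (simp add: U.\<sigma>_mult)
    have 2: "w * i' = ?\<sigma> i' * w + w" using wI(1) by (simp add: I_def distrib_right)
    show ?thesis unfolding 1 unfolding 2 by (simp add: add.assoc add.left_commute U.add_self_left U.add_self)
  qed
  moreover have "w * i' \<in> ?B" using w gens by (intro U.B_mult)
  ultimately obtain t0 where t0: "w = U.emb t0" using U.symd_emb by metis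
  define N where "N = albert a b c d t0"
  have cw: "U.cemb t0 * w = s N" "w * U.cemb t0 = s N"
    by (simp_all add: t0 U.emb_cemb N_def)
  \<comment> \<open>If N = 0, moving w past z makes \<open>U.cemb t0 * z * w\<close> vanish for
    every z in B, against primeness.\<close>
  have N: "N \<noteq> 0"
  proof
    assume N: "N = 0"
    have "U.cemb t0 * z * w = 0" if z: "z \<in> ?B" for z
    proof -
      have "z * w = w * ?\<tau> (?\<sigma> z)"
        using w_\<tau>[OF U.\<sigma>_in_B[OF z]] by (simp add: U.\<sigma>_\<sigma> z)
      then have "U.cemb t0 * z * w = U.cemb t0 * w * ?\<tau> (?\<sigma> z)" by (simp add: mult.assoc)
      then show ?thesis by (simp add: cw N U.s_zero)
    qed
    then have "U.cemb t0 = 0 \<or> w = 0"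
      by (rule U.prime_B[rotated]) (auto simp: U.cemb_def intro!: U.B_add U.emb_in_B U.s_in_B)
    then show False using w(2) t0 U.cemb_eq_0 U.emb_eq_0 by auto
  qed
  have ex1: "\<exists>t. w * V.emb y = U.emb t" for y
  proof -
    obtain x where x: "x \<in> ?B" "V.emb y = x + ?\<tau> x" using V.emb_symd[of y] unfolding B_eq by blast
    have "w * V.emb y = w * x + ?\<sigma> (w * x)"
      using x w w_\<tau>[OF x(1)] by (simp add: distrib_left U.\<sigma>_mult)
    then show ?thesis using U.symd_emb[of "w * x"] x w U.B_mult by metis
  qed
  have ex2: "\<exists>y. w * V.emb y = U.emb t" for t
  proof -
    obtain x where x: "x \<in> ?B" "U.emb t = x + ?\<sigma> x" using U.emb_symd[of t] by blast
    \<comment> \<open>This is the inverse of w applied to x.\<close>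
    define x' where "x' = s (1 / N) * (U.cemb t0 * x)"
    have x': "x' \<in> ?B" unfolding x'_def
      by (auto simp: U.cemb_def intro!: U.B_scale U.B_mult U.B_add U.emb_in_B U.s_in_B x)
    have "w * x' = s (1 / N) * (w * U.cemb t0 * x)"
      unfolding x'_def by (simp only: U.s_left[of w] mult.assoc)
    also have "\<dots> = x" using N by (simp add: cw U.s_s U.s_one)
    finally have wx: "w * x' = x" .
    have "w * (x' + ?\<tau> x') = U.emb t"
    proof -
      have "?\<sigma> x = ?\<sigma> x' * w" using U.\<sigma>_mult[OF w(1) x'] by (simp only: wx w(3))
      then show ?thesis using x(2) wx w_\<tau>[OF x'] by (simp only: distrib_left)
    qed
    moreover obtain y where "x' + ?\<tau> x' = V.emb y"
      using V.symd_emb[of x'] x' unfolding B_eq by blast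
    ultimately show ?thesis by metis
  qed
  define g where "g y = (SOME t. w * V.emb y = U.emb t)" for y
  have g: "U.emb (g y) = w * V.emb y" for y
    unfolding g_def using someI_ex[OF ex1[of y]] by simp
  have w_cancel: "x = 0" if "w * x = 0" for x
  proof -
    have "s N * x = U.cemb t0 * (w * x)" by (simp add: cw flip: mult.assoc)
    then show ?thesis using that N U.s_cancel by simp
  qed
  show ?thesis
  proof (rule that[of g N])
    show add: "g (x + y) = g x + g y" for x y
      by (rule U.emb_inj) (simp add: g V.emb_add U.emb_add distrib_left)
    show "g (scl6 e x) = scl6 e (g x)" for e x
      by (rule U.emb_inj) (simp add: g V.emb_scl U.emb_scl U.s_left[of w])
    show "bij g"
    proof (rule bijI)
      show "inj g"
      proof (rule injI)
        fix x y assume "g x = g y"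
        then have "w * V.emb x = w * V.emb y" by (metis g)
        then have "w * (V.emb x + V.emb y) = 0" by (simp add: distrib_left U.add_self)
        then have "V.emb x + V.emb y = 0" by (rule w_cancel)
        then show "x = y" by (simp add: U.add_eq_0 V.emb_inj)
      qed
      show "surj g"
        using ex2 g U.emb_inj unfolding surj_def by metis
    qed
    show "N \<noteq> 0" by fact
    fix y
    define t where "t = g y"
    define Y where "Y = V.emb y"
    \<comment> \<open>The polar form of the Albert form at t0 and t. Polarizing
      \<open>U.emb_cemb\<close> at t0 + t gives the exchange rule \<open>anti\<close> below.\<close>
    define \<beta> where "\<beta> = albert a b c d (t0 + t) + albert a b c d t0 + albert a b c d t"
    have t: "U.emb t = w * Y" by (simp add: t_def Y_def g)
    have "w * U.cemb t + U.emb t * U.cemb t0 = s \<beta>"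
    proof -
      have "(w + U.emb t) * (U.cemb t0 + U.cemb t) = s (albert a b c d (t0 + t))"
        using U.emb_cemb(1)[of "t0 + t"] by (simp add: t0 U.emb_add U.cemb_add)
      then have "w * U.cemb t0 + (w * U.cemb t + U.emb t * U.cemb t0) + U.emb t * U.cemb t
          = s (albert a b c d (t0 + t))"
        by (simp add: distrib_left distrib_right add_ac)
      then have "s N + (w * U.cemb t + U.emb t * U.cemb t0) + s (albert a b c d t)
          = s (albert a b c d (t0 + t))"
        by (simp add: cw U.emb_cemb)
      then have "(s N + s (albert a b c d t)) + (w * U.cemb t + U.emb t * U.cemb t0)
          = s (albert a b c d (t0 + t)) + 0"
        by (simp add: add_ac)
      from U.add_exchange[OF this] show ?thesis
        by (simp add: \<beta>_def N_def U.s_add add_ac)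
    qed
    then have "w * U.cemb t + s \<beta> = U.emb t * U.cemb t0 + 0"
      using U.add_exchange[of "w * U.cemb t" "U.emb t * U.cemb t0" "s \<beta>" 0] by simp
    then have anti: "U.emb t * U.cemb t0 = s \<beta> + w * U.cemb t"
      by (simp add: add.commute[of "s \<beta>"])
    \<comment> \<open>The square of N Y yields a quadratic equation for Y with data from the first
      decomposition; \<open>V.emb_square\<close> yields one with data from the second. Their
      difference is linear in Y.\<close>
    have cx: "U.cemb t0 * U.emb t = s N * Y"
      by (simp add: t cw flip: mult.assoc)
    have "s N * Y * (s N * Y) = U.cemb t0 * (U.emb t * U.cemb t0) * U.emb t"
      by (simp add: mult.assoc flip: cx)
    also have "\<dots> = s \<beta> * (U.cemb t0 * U.emb t) + U.cemb t0 * w * (U.cemb t * U.emb t)"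
      unfolding anti by (simp add: distrib_left distrib_right mult.assoc U.s_central[of "U.cemb t0"] U.s_left[of "U.cemb t0"])
    also have "\<dots> = s \<beta> * (s N * Y) + s N * s (albert a b c d t)"
      by (simp only: cx cw U.emb_cemb)
    finally have YY: "s N * Y * (s N * Y) = s \<beta> * (s N * Y) + s N * s (albert a b c d t)" .
    have "Y * Y = s (tr6 y) * Y + s (albert a' b' c' d' y)"
      unfolding Y_def by (rule V.emb_square)
    then have "s (N * N) * (s (tr6 y) * Y + s (albert a' b' c' d' y)) = s N * Y * (s N * Y)"
      by (simp add: U.s_mult mult.assoc U.s_left[of Y])
    then have "s N * (s (N * tr6 y) * Y) + s N * s (N * albert a' b' c' d' y)
        = s N * (s \<beta> * Y) + s N * s (albert a b c d t)"
      unfolding YY by (simp add: distrib_left U.s_s mult_ac flip: U.s_mult)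
    from U.add_exchange[OF this] have "s N * (s (N * tr6 y + \<beta>) * Y
        + s (N * albert a' b' c' d' y + albert a b c d t)) = 0"
      by (simp add: U.s_add distrib_left distrib_right U.add_self)
    then have "s (N * tr6 y + \<beta>) * Y + s (N * albert a' b' c' d' y + albert a b c d t) = 0"
      using U.s_cancel[OF N] by blast
    then have lin: "s (N * tr6 y + \<beta>) * Y = s (N * albert a' b' c' d' y + albert a b c d t)"
      by (simp only: U.add_eq_0)
    \<comment> \<open>If the coefficient of Y in the linear relation vanishes, so does the constant
      term, which is the claim. Otherwise Y is a scalar z and t is z times t0, so both sides can be
      computed.\<close>
    show "albert a b c d (g y) = N * albert a' b' c' d' y"
    proof (cases "N * tr6 y + \<beta> = 0")
      case True
      with lin have "s (N * albert a' b' c' d' y + albert a b c d t) = 0" by (simp add: U.s_zero)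
      then have "N * albert a' b' c' d' y + albert a b c d t = 0" by (simp only: U.s_inj0)
      then show ?thesis by (simp add: U.add_eq_0_F t_def)
    next
      case False
      define e where "e = N * tr6 y + \<beta>"
      define z where "z = (N * albert a' b' c' d' y + albert a b c d t) / e"
      have "Y = s (1 / e) * (s e * Y)" using False by (simp add: U.s_s U.s_one e_def)
      also have "\<dots> = s z" unfolding e_def lin by (simp add: z_def e_def flip: U.s_mult)
      finally have Y: "Y = s z" .
      then have "y = (z, 0, 0, 0, 0, 0)" by (intro V.emb_inj) (simp add: Y_def V.emb_scalar)
      moreover have "t = scl6 z t0"
        by (rule U.emb_inj) (simp add: t Y U.emb_scl t0 U.s_central)
      moreover have "albert a b c d (scl6 z t0) = z\<^sup>2 * N"
        by (cases t0) (simp add: N_def albert_def scl6_def algebra_simps power2_eq_square)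
      moreover have "albert a' b' c' d' (z, 0, 0, 0, 0, 0) = z\<^sup>2"
        by (simp add: albert_def)
      ultimately show ?thesis unfolding t_def[symmetric] by (simp add: mult.commute)
    qed
  qed
qed

lemma albert_similar_of_alg_iso:
  fixes a b c d a' b' c' d' :: "'a::field"
  assumes 2: "(1::'a) + 1 = 0" and nz: "b \<noteq> 0" "d \<noteq> 0" "b' \<noteq> 0" "d' \<noteq> 0"
    and iso: "alg_iso (alg_tensor (quat a' b') (quat c' d')) (alg_tensor (quat a b) (quat c d))"
  obtains g r where "bij g" "\<And>x y. g (x + y) = g x + g y" "\<And>e x. g (scl6 e x) = scl6 e (g x)"
    "r \<noteq> 0" "\<And>x. albert a b c d (g x) = r * albert a' b' c' d' x"
proof -
  interpret U: biquat scalar16 a b "i16 a" "j16 b" c d "k16 c" "l16 d"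
    by (rule biquat_16) fact+
  let ?sc = "snd (alg_tensor (quat a b) (quat c d))"
  let ?sc' = "snd (alg_tensor (quat a' b') (quat c' d'))"
  have 16: "fst (alg_tensor (quat a' b') (quat c' d')) = 16" for a' b' c' d' :: 'a
    by (simp add: alg_tensor_def quat_def)
  from iso obtain M N where
    NM: "\<forall>i<16. \<forall>j<16. (\<Sum>k<16. N i k * M k j) = (if i = j then 1 else 0)"
    and M: "\<forall>i<16. \<forall>j<16. \<forall>l<16. (\<Sum>k<16. ?sc' i j k * M k l)
          = (\<Sum>p<16. \<Sum>q<16. M i p * M j q * ?sc p q l)"
    unfolding alg_iso_def 16 by (elim conjE exE) (rule that)
  \<comment> \<open>Images of the basis of the primed tensor product, placed in the ring of the
    other one. By the index rule, i', j', k', l' become \<open>h 4\<close>, \<open>h 8\<close>,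
    \<open>h 1\<close>, \<open>h 2\<close>.\<close>
  define h where "h p = U.lin 16 U.tensor_basis (M p)" for p
  have h_lin: "U.lin 16 h X = U.lin 16 U.tensor_basis (\<lambda>k. \<Sum>p<16. X p * M p k)" for X
    using U.lin_lin[of 16 16 U.tensor_basis M X] by (simp add: h_def[abs_def])
  have hh: "h p * h q = U.lin 16 h (?sc' p q)" if "p < 16" "q < 16" for p q
  proof -
    have "h p * h q = U.lin 16 U.tensor_basis (\<lambda>l. \<Sum>r<16. \<Sum>t<16. M p r * M q t * ?sc r t l)"
      unfolding h_def by (rule U.lin_mult) (rule U.tensor_basis_mult)
    also have "\<dots> = U.lin 16 U.tensor_basis (\<lambda>l. \<Sum>k<16. ?sc' p q k * M k l)"
      by (rule U.lin_cong) (use M that in simp)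
    finally show ?thesis by (simp only: h_lin)
  qed
  have tensor_basis_h: "U.tensor_basis p = U.lin 16 h (N p)" if "p < 16" for p
  proof -
    have "U.lin 16 h (N p) = U.lin 16 U.tensor_basis (\<lambda>k. if k = p then 1 else 0)"
      unfolding h_lin by (rule U.lin_cong) (use NM that in auto)
    then show ?thesis using that by (simp add: U.lin_basis)
  qed
  have delta: "h p * h q = h r" if "p < 16" "q < 16" "r < 16"
    "\<And>k. k < 16 \<Longrightarrow> ?sc' p q k = (if k = r then 1 else 0)" for p q r
    using that U.lin_cong[of 16 "?sc' p q" "\<lambda>k. if k = r then 1 else 0" h]
    by (simp add: hh U.lin_basis)
  have split: "(k = r) = (k div 4 = r div 4 \<and> k mod 4 = r mod 4)" for k r :: nat
    by (metis div_mult_mod_eq)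
  have h_prod: "h (4 * p) * h q = h (4 * p + q)" if "p < 4" "q < 4" for p q
    using that by (intro delta) (auto simp: alg_tensor_def quat_def quat_prod_def split[of _ "4 * p + q"])
  \<comment> \<open>\<open>alg_iso\<close> does not mention units. However, \<open>h 0\<close> is a
    left unit on the span of h, and this span contains 1.\<close>
  have h0: "h 0 = 1"
  proof -
    have 0: "h 0 * h q = h q" if "q < 16" for q
      using that by (intro delta) (auto simp: alg_tensor_def quat_def quat_prod_def split[of _ q])
    have "h 0 * U.lin 16 h X = U.lin 16 h X" for X
      unfolding U.lin_def sum_distrib_left
      by (intro sum.cong refl) (simp add: U.s_left[of "h 0"] 0)
    from this[of "N 0"] have "h 0 * U.tensor_basis 0 = U.tensor_basis 0" by (simp add: tensor_basis_h)
    then show ?thesis by (simp add: U.tensor_basis_def)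
  qed
  have prods: "h 4 * h 8 = h 12" "h 1 * h 2 = h 3"
  proof -
    show "h 4 * h 8 = h 12"
    proof (rule delta)
      show "?sc' 4 8 r = (if r = 12 then 1 else 0)" for r
        using split[of r 12] by (simp add: alg_tensor_def quat_def quat_prod_def vec4_def)
    qed simp_all
    show "h 1 * h 2 = h 3"
    proof (rule delta)
      show "?sc' 1 2 r = (if r = 3 then 1 else 0)" for r
        using split[of r 3] by (simp add: alg_tensor_def quat_def quat_prod_def vec4_def)
    qed simp_all
  qed
  have V: "biquat scalar16 a' b' (h 4) (h 8) c' d' (h 1) (h 2)"
  proof unfold_locales
    note eval = hh U.lin_16 sum_lessThan_4 alg_tensor_def quat_def quat_prod_def vec4_def U.s_zero U.s_one h0 add_ac
    show "h 4 * h 4 = h 4 + scalar16 a'" "h 8 * h 8 = scalar16 b'"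
      "h 1 * h 1 = h 1 + scalar16 c'" "h 2 * h 2 = scalar16 d'"
      "h 8 * h 4 = h 4 * h 8 + h 8" "h 2 * h 1 = h 1 * h 2 + h 2"
      by (simp_all add: eval del: add_2_eq_Suc add_2_eq_Suc')
    show "h 1 * h 4 = h 4 * h 1" "h 1 * h 8 = h 8 * h 1" "h 2 * h 4 = h 4 * h 2" "h 2 * h 8 = h 8 * h 2"
      by (simp_all add: eval del: add_2_eq_Suc add_2_eq_Suc')
  qed fact+
  interpret V: biquat scalar16 a' b' "h 4" "h 8" c' d' "h 1" "h 2" by (rule V)
  have tensor_basis': "V.tensor_basis p = h p" if p: "p < 16" for p
  proof -
    have "quat_basis (h 4) (h 8) (p div 4) = h (4 * (p div 4))" "quat_basis (h 1) (h 2) (p mod 4) = h (p mod 4)"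
      using less_4_iff[of "p div 4"] less_4_iff[of "p mod 4"] p prods by (auto simp: h0)
    then show ?thesis
      unfolding V.tensor_basis_def using p h_prod[of "p div 4" "p mod 4"] by (simp add: less_mult_imp_div_less)
  qed
  have "U.lin 16 V.tensor_basis = U.lin 16 h"
    unfolding U.lin_def by (intro ext sum.cong refl) (simp add: tensor_basis' del: One_nat_def)
  then have "V.B = range (U.lin 16 h)" unfolding V.B_def by (simp only:)
  also have "\<dots> = U.B"
  proof
    show "range (U.lin 16 h) \<subseteq> U.B" by (auto simp: h_lin U.B_def)
    have "U.lin 16 U.tensor_basis X = U.lin 16 (\<lambda>p. U.lin 16 h (N p)) X" for X
      unfolding U.lin_def[of 16 U.tensor_basis] U.lin_def[of 16 "\<lambda>p. U.lin 16 h (N p)"]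
      by (intro sum.cong refl) (simp add: tensor_basis_h)
    then show "U.B \<subseteq> range (U.lin 16 h)" by (auto simp: U.B_def U.lin_lin)
  qed
  finally have VB: "V.B = U.B" .
  show ?thesis
    by (rule albert_similar[OF U.biquat_axioms V VB]) (rule that)
qed

subsection \<open>Frames of a quadratic space\<close>

text \<open>No dimension or nondegeneracy is assumed; the existence of a frame supplies
  both.\<close>

locale quad_space =
  fixes scl :: "'a::field \<Rightarrow> 'v::ab_group_add \<Rightarrow> 'v" and q :: "'v \<Rightarrow> 'a" and B :: "'v \<Rightarrow> 'v \<Rightarrow> 'a"
  assumes scl_add_right: "scl e (x + y) = scl e x + scl e y"
    and scl_add_left: "scl (e + f) x = scl e x + scl f x"
    and scl_scl: "scl e (scl f x) = scl (e * f) x"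
    and scl_one: "scl 1 x = x"
    and q_scl: "q (scl e x) = e\<^sup>2 * q x"
    and q_add: "q (x + y) = q x + q y + B x y"
    and B_add_left: "B (x + y) z = B x z + B y z"
    and B_scl_left: "B (scl e x) z = e * B x z"
    and two: "(1::'a) + 1 = 0"
begin

lemma F2: "(e::'a) + e = 0" "(e::'a) + (e + f) = f"
proof -
  have "e + e = (1 + 1) * e" by (simp only: distrib_right mult_1)
  then show 1: "e + e = 0" by (simp only: two mult_zero_left)
  then show "e + (e + f) = f" by (simp flip: add.assoc)
qed

lemma F_eq: "(e::'a) + f = 0 \<longleftrightarrow> e = f"
  by (metis F2(1) add_right_cancel)

lemma scl_zero: "scl 0 x = 0"
  using scl_add_left[of 0 0 x] by simp

lemma V2: "(x::'v) + x = 0" "(x::'v) + (x + y) = y"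
proof -
  have "x + x = scl (1 + 1) x" by (simp only: scl_add_left scl_one)
  then show 1: "x + x = 0" by (simp only: two scl_zero)
  then show "x + (x + y) = y" by (simp flip: add.assoc)
qed

lemma B_sym: "B x y = B y x"
  using q_add[of x y] q_add[of y x] by (simp add: add.commute)

lemma B_add_right: "B z (x + y) = B z x + B z y"
  using B_add_left[of x y z] by (simp add: B_sym)

lemma B_scl_right: "B z (scl e x) = e * B z x"
  using B_scl_left[of e x z] by (simp add: B_sym)

lemma scl_zero_right: "scl e 0 = 0"
  using scl_add_right[of e 0 0] by simp

lemma q_zero: "q 0 = 0"
  using q_scl[of 0 0] by (simp add: scl_zero)

lemma B_self: "B x x = 0"
  using q_add[of x x] by (simp add: V2 q_zero F2)

lemmas V_simps = scl_add_right scl_add_left scl_scl scl_one scl_zero scl_zero_right q_scl q_add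
  B_add_left B_add_right B_scl_left B_scl_right B_self F2 V2 add_ac

lemmas F_simps = F2 power2_eq_square distrib_left distrib_right add_ac mult_ac

definition span3 :: "'v \<Rightarrow> 'v \<Rightarrow> 'v \<Rightarrow> 'v set" where
  "span3 v x y = {z. \<exists>e f g. z = scl e v + scl f x + scl g y}"

lemma span3_add: "z \<in> span3 v x y \<Longrightarrow> z' \<in> span3 v x y \<Longrightarrow> z + z' \<in> span3 v x y"
proof -
  assume "z \<in> span3 v x y" "z' \<in> span3 v x y"
  then obtain a b c a' b' c' where "z = scl a v + scl b x + scl c y"
    "z' = scl a' v + scl b' x + scl c' y" unfolding span3_def by blast
  then have "z + z' = scl (a + a') v + scl (b + b') x + scl (c + c') y"
    by (simp add: V_simps)
  then show "z + z' \<in> span3 v x y" unfolding span3_def by blast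
qed

lemma span3_scl: "z \<in> span3 v x y \<Longrightarrow> scl e z \<in> span3 v x y"
proof -
  assume "z \<in> span3 v x y"
  then obtain a b c where "z = scl a v + scl b x + scl c y" unfolding span3_def by blast
  then have "scl e z = scl (e * a) v + scl (e * b) x + scl (e * c) y"
    by (simp add: V_simps)
  then show "scl e z \<in> span3 v x y" unfolding span3_def by blast
qed

lemmas span3_closed = span3_add span3_scl

lemma span3_base: "v \<in> span3 v x y" "x \<in> span3 v x y" "y \<in> span3 v x y"
proof -
  have "v = scl 1 v + scl 0 x + scl 0 y" "x = scl 0 v + scl 1 x + scl 0 y" "y = scl 0 v + scl 0 x + scl 1 y"
    by (simp_all add: V_simps)
  then show "v \<in> span3 v x y" "x \<in> span3 v x y" "y \<in> span3 v x y" unfolding span3_def by blast+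
qed

lemma span3_subset:
  "v' \<in> span3 v x y \<Longrightarrow> x' \<in> span3 v x y \<Longrightarrow> y' \<in> span3 v x y \<Longrightarrow> span3 v' x' y' \<subseteq> span3 v x y"
  unfolding span3_def[of v' x' y'] by (auto intro!: span3_closed)

text \<open>A three-dimensional subspace of the Albert space with radical v determines a quaternion
  algebra; any of its hyperbolic pairs (y, y1) gives a presentation.\<close>

definition presents :: "'a alg \<Rightarrow> 'v \<Rightarrow> 'v \<Rightarrow> 'v \<Rightarrow> bool" where
  "presents Q v x x1 \<longleftrightarrow> (\<forall>y\<in>span3 v x x1. \<forall>y1\<in>span3 v x x1. B y y1 = 1 \<longrightarrow> q y \<noteq> 0 \<longrightarrow>
     alg_iso Q (quat (q y * q y1) (q v * q y)))"

lemma presentsD: "presents Q v x x1 \<Longrightarrow> y \<in> span3 v x x1 \<Longrightarrow> y1 \<in> span3 v x x1 \<Longrightarrow> B y y1 = 1 \<Longrightarrow> q y \<noteq> 0 \<Longrightarrow>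
    alg_iso Q (quat (q y * q y1) (q v * q y))"
  unfolding presents_def by blast

lemma presents_mono: "presents Q v x x1 \<Longrightarrow> x' \<in> span3 v x x1 \<Longrightarrow> x1' \<in> span3 v x x1 \<Longrightarrow> presents Q v x' x1'"
  unfolding presents_def using span3_subset[OF span3_base(1)] by blast

text \<open>On the span of v, x, x1 the form is that of \<open>alg_iso_ternary\<close> with r = q v,
  \<alpha> = q x, \<beta> = q x1, so one presentation yields all others.\<close>

lemma presentsI:
  assumes Q: "alg_iso Q (quat (q x * q x1) (q v * q x))"
    and B: "B x x1 = 1" "B v x = 0" "B v x1 = 0" and nz: "q v \<noteq> 0" "q x \<noteq> 0"
  shows "presents Q v x x1"
  unfolding presents_def
proof (intro ballI impI)
  fix y y1 assume y: "y \<in> span3 v x x1" "y1 \<in> span3 v x x1" "B y y1 = 1" "q y \<noteq> 0"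
  then obtain e f g e' f' g' where z: "y = scl e v + scl f x + scl g x1"
    "y1 = scl e' v + scl f' x + scl g' x1" unfolding span3_def by blast
  have B': "B x v = 0" "B x1 v = 0" "B x1 x = 1" using B by (simp_all add: B_sym)
  have "alg_iso (quat (q y * q y1) (q v * q y)) (quat (q x * q x1) (q v * q x))"
  proof (rule alg_iso_ternary[OF two nz y(4)])
    show "q y = e\<^sup>2 * q v + f\<^sup>2 * q x + f * g + g\<^sup>2 * q x1"
      "q y1 = e'\<^sup>2 * q v + f'\<^sup>2 * q x + f' * g' + g'\<^sup>2 * q x1"
      by (simp_all add: z V_simps B B')
    show "f * g' + f' * g = 1"
      using y(3) by (simp add: z V_simps B B' mult_ac)
  qed
  with Q show "alg_iso Q (quat (q y * q y1) (q v * q y))"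
    using alg_iso_sym alg_iso_trans by blast
qed

definition expand :: "'v \<Rightarrow> 'v \<Rightarrow> 'v \<Rightarrow> 'v \<Rightarrow> 'v \<Rightarrow> 'v \<Rightarrow> 'v \<Rightarrow> 'v" where
  "expand v w x x1 p p1 z = scl (B z w) v + scl (B z v) w + scl (B z x1) x + scl (B z x) x1
     + scl (B z p1) p + scl (B z p) p1"

text \<open>A symplectic basis of three orthogonal hyperbolic planes. Coordinates are read off
  through B, so the condition on \<open>expand\<close> says that the six vectors span.\<close>

definition frame :: "'v \<Rightarrow> 'v \<Rightarrow> 'v \<Rightarrow> 'v \<Rightarrow> 'v \<Rightarrow> 'v \<Rightarrow> bool" where
  "frame v w x x1 p p1 \<longleftrightarrow> B v w = 1 \<and> B x x1 = 1 \<and> B p p1 = 1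
     \<and> B v x = 0 \<and> B v x1 = 0 \<and> B v p = 0 \<and> B v p1 = 0
     \<and> B w x = 0 \<and> B w x1 = 0 \<and> B w p = 0 \<and> B w p1 = 0
     \<and> B x p = 0 \<and> B x p1 = 0 \<and> B x1 p = 0 \<and> B x1 p1 = 0
     \<and> (\<forall>z. expand v w x x1 p p1 z = z)"

lemma frameD:
  assumes "frame v w x x1 p p1"
  shows "B v w = 1" "B x x1 = 1" "B p p1 = 1"
    "B v x = 0" "B v x1 = 0" "B v p = 0" "B v p1 = 0"
    "B w x = 0" "B w x1 = 0" "B w p = 0" "B w p1 = 0"
    "B x p = 0" "B x p1 = 0" "B x1 p = 0" "B x1 p1 = 0"
    "B w v = 1" "B x1 x = 1" "B p1 p = 1"
    "B x v = 0" "B x1 v = 0" "B p v = 0" "B p1 v = 0"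
    "B x w = 0" "B x1 w = 0" "B p w = 0" "B p1 w = 0"
    "B p x = 0" "B p1 x = 0" "B p x1 = 0" "B p1 x1 = 0"
  using assms unfolding frame_def by (simp_all add: B_sym)

lemma frame_expand: "frame v w x x1 p p1 \<Longrightarrow> expand v w x x1 p p1 z = z"
  by (simp add: frame_def)

lemma expand_add: "expand v w x x1 p p1 (y + z) = expand v w x x1 p p1 y + expand v w x x1 p p1 z"
  by (simp add: expand_def V_simps)

lemma expand_scl: "expand v w x x1 p p1 (scl e z) = scl e (expand v w x x1 p p1 z)"
  by (simp add: expand_def V_simps)

lemma frame_change:
  assumes f: "frame v w x x1 p p1"
    and new: "\<And>z. z \<in> {v, w, x, x1, p, p1} \<Longrightarrow> expand v' w' x' x1' p' p1' z = z"
  shows "expand v' w' x' x1' p' p1' z = z"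
proof -
  let ?E = "expand v' w' x' x1' p' p1'"
  have "?E z = ?E (expand v w x x1 p p1 z)" by (simp add: frame_expand[OF f])
  also have "\<dots> = expand v w x x1 p p1 z"
    unfolding expand_def[of v w x x1 p p1] expand_add expand_scl by (simp add: new)
  finally show ?thesis by (simp add: frame_expand[OF f])
qed

lemma frame_changeI:
  assumes f: "frame v w x x1 p p1"
    and "B v' w' = 1 \<and> B x' x1' = 1 \<and> B p' p1' = 1
     \<and> B v' x' = 0 \<and> B v' x1' = 0 \<and> B v' p' = 0 \<and> B v' p1' = 0
     \<and> B w' x' = 0 \<and> B w' x1' = 0 \<and> B w' p' = 0 \<and> B w' p1' = 0
     \<and> B x' p' = 0 \<and> B x' p1' = 0 \<and> B x1' p' = 0 \<and> B x1' p1' = 0"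
    and "\<And>z. z \<in> {v, w, x, x1, p, p1} \<Longrightarrow> expand v' w' x' x1' p' p1' z = z"
  shows "frame v' w' x' x1' p' p1'"
  using assms(2) frame_change[OF f assms(3)] unfolding frame_def by blast

text \<open>The sum of the three products is the Arf invariant in this symplectic basis, which is
  meaningful up to elements e^2 + e. The condition says that it is trivial, and it is what allows
  matching presentations to be chosen.\<close>

definition adapted :: "'a alg \<times> 'a alg \<Rightarrow> 'v \<Rightarrow> 'v \<Rightarrow> 'v \<Rightarrow> 'v \<Rightarrow> 'v \<Rightarrow> 'v \<Rightarrow> bool" where
  "adapted U v w x x1 p p1 \<longleftrightarrow> frame v w x x1 p p1 \<and> q v \<noteq> 0
     \<and> (\<exists>e. q v * q w + q x * q x1 + q p * q p1 = e\<^sup>2 + e)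
     \<and> presents (fst U) v x x1 \<and> presents (snd U) v p p1"

lemma adapted_swap: "adapted U v w x x1 p p1 \<Longrightarrow> adapted (prod.swap U) v w p p1 x x1"
  unfolding adapted_def frame_def expand_def by (auto simp: add_ac B_sym)

lemma adapted_flip: "adapted U v w x x1 p p1 \<Longrightarrow> adapted U v w x1 x p p1"
  unfolding adapted_def frame_def expand_def
  by (elim conjE, intro conjI; (rule presents_mono, assumption, rule span3_base, rule span3_base)?)
    (auto simp: add_ac mult_ac B_sym)

lemma adapted_add:
  assumes "adapted U v w x x1 p p1" shows "adapted U v w (x + scl e x1) x1 p p1"
proof -
  from assms have f: "frame v w x x1 p p1" by (simp add: adapted_def)
  note B = frameD[OF f]
  obtain g where g: "q v * q w + q x * q x1 + q p * q p1 = g\<^sup>2 + g" using assms by (auto simp: adapted_def)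
  have "frame v w (x + scl e x1) x1 p p1"
    by (rule frame_changeI[OF f]) (auto simp: expand_def V_simps B)
  moreover have "q v * q w + q (x + scl e x1) * q x1 + q p * q p1 = (g + e * q x1)\<^sup>2 + (g + e * q x1)"
  proof -
    have "q v * q w + q (x + scl e x1) * q x1 + q p * q p1
        = (q v * q w + q x * q x1 + q p * q p1) + (e * q x1)\<^sup>2 + e * q x1"
      by (simp add: V_simps B F_simps)
    then show ?thesis unfolding g by (simp add: F_simps)
  qed
  moreover have "presents (fst U) v (x + scl e x1) x1"
    by (rule presents_mono[of _ _ x x1]; (intro span3_closed span3_base)?) (use assms in \<open>simp add: adapted_def\<close>)
  ultimately show ?thesis using assms unfolding adapted_def by blast
qed

lemma adapted_scale:
  assumes "adapted U v w x x1 p p1" "e \<noteq> 0" shows "adapted U v w (scl e x) (scl (1 / e) x1) p p1"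
proof -
  from assms have f: "frame v w x x1 p p1" by (simp add: adapted_def)
  note B = frameD[OF f]
  have "frame v w (scl e x) (scl (1 / e) x1) p p1"
    by (rule frame_changeI[OF f]) (use assms(2) in \<open>auto simp: expand_def V_simps B\<close>)
  moreover have "q (scl e x) * q (scl (1 / e) x1) = q x * q x1"
    using assms(2) by (simp add: V_simps power2_eq_square)
  moreover have "presents (fst U) v (scl e x) (scl (1 / e) x1)"
    by (rule presents_mono[of _ _ x x1]; (intro span3_closed span3_base)?) (use assms in \<open>simp add: adapted_def\<close>)
  ultimately show ?thesis using assms unfolding adapted_def by simp
qed

lemma presents_scale:
  assumes "presents Q v x x1" "q v \<noteq> 0" "e \<noteq> 0" shows "presents Q (scl e v) x x1"
  unfolding presents_def
proof (intro ballI impI)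
  fix y y1 assume y: "y \<in> span3 (scl e v) x x1" "y1 \<in> span3 (scl e v) x x1" "B y y1 = 1" "q y \<noteq> 0"
  have "span3 (scl e v) x x1 \<subseteq> span3 v x x1"
    by (intro span3_subset span3_closed span3_base)
  then have "alg_iso Q (quat (q y * q y1) (q v * q y))"
    using y by (intro presentsD[OF assms(1)]) auto
  moreover have "alg_iso (quat (q y * q y1) (q v * q y)) (quat (q y * q y1) (q v * q y * e\<^sup>2))"
    by (rule alg_iso_sym, rule alg_iso_quat_square[OF two]) (use assms y in auto)
  moreover have "q v * q y * e\<^sup>2 = q (scl e v) * q y" by (simp add: q_scl mult_ac)
  ultimately show "alg_iso Q (quat (q y * q y1) (q (scl e v) * q y))"
    using alg_iso_trans by metis
qed

lemma adapted_scale_base: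
  assumes "adapted U v w x x1 p p1" "e \<noteq> 0" shows "adapted U (scl e v) (scl (1 / e) w) x x1 p p1"
proof -
  from assms have f: "frame v w x x1 p p1" by (simp add: adapted_def)
  note B = frameD[OF f]
  have "frame (scl e v) (scl (1 / e) w) x x1 p p1"
    by (rule frame_changeI[OF f]) (use assms(2) in \<open>auto simp: expand_def V_simps B\<close>)
  moreover have "q (scl e v) * q (scl (1 / e) w) = q v * q w" "q (scl e v) \<noteq> 0"
    using assms by (simp_all add: V_simps power2_eq_square adapted_def)
  ultimately show ?thesis using assms presents_scale unfolding adapted_def by simp
qed

lemma adapted_anisotropic:
  assumes "adapted U v w x x1 p p1"
  obtains p' p1' where "adapted U v w x x1 p' p1'" "q p' \<noteq> 0"
proof (cases "q p = 0 \<and> q p1 = 0")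
  case True
  have "B p p1 = 1" using assms by (auto simp: adapted_def frame_def)
  then have "q (p + scl 1 p1) \<noteq> 0" using True by (simp add: V_simps)
  moreover have "adapted U v w x x1 (p + scl 1 p1) p1"
    using adapted_swap[OF adapted_add[OF adapted_swap[OF assms]]] by simp
  ultimately show ?thesis by (rule that[rotated])
next
  case False
  moreover have "adapted U v w x x1 p1 p"
    using adapted_swap[OF adapted_flip[OF adapted_swap[OF assms]]] by simp
  ultimately show ?thesis using that assms by blast
qed

text \<open>Any t with B v t = 1 may replace w if the other four vectors are made orthogonal to t by
  adding multiples of v. The two spans through v that determine the algebras do not change.\<close>

lemma adapted_shear:
  assumes "adapted U v w x x1 p p1" "B v t = 1"
  shows "adapted U v t (x + scl (B x t) v) (x1 + scl (B x1 t) v) (p + scl (B p t) v) (p1 + scl (B p1 t) v)"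
proof -
  from assms have f: "frame v w x x1 p p1" by (simp add: adapted_def)
  note B = frameD[OF f]
  obtain g where g: "q v * q w + q x * q x1 + q p * q p1 = g\<^sup>2 + g" using assms by (auto simp: adapted_def)
  define \<tau> e e1 h h1 where "\<tau> = B t w" and "e = B x t" and "e1 = B x1 t" and "h = B p t" and "h1 = B p1 t"
  have t: "t = scl \<tau> v + w + scl e1 x + scl e x1 + scl h1 p + scl h p1"
    using frame_expand[OF f, of t] assms(2)
    by (simp add: expand_def \<tau>_def e_def e1_def h_def h1_def B_sym[of t] scl_one)
  let ?x = "x + scl e v" and ?x1 = "x1 + scl e1 v" and ?p = "p + scl h v" and ?p1 = "p1 + scl h1 v"
  have "frame v t ?x ?x1 ?p ?p1"
    unfolding t
    by (rule frame_changeI[OF f]) (auto simp: expand_def V_simps B mult_ac)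
  moreover have "\<exists>g. q v * q t + q ?x * q ?x1 + q ?p * q ?p1 = g\<^sup>2 + g"
  proof -
    let ?d = "\<tau> * q v + e * e1 * q v + h * h1 * q v"
    have "q v * q t + q ?x * q ?x1 + q ?p * q ?p1
        = (q v * q w + q x * q x1 + q p * q p1) + (?d\<^sup>2 + ?d)"
      unfolding t by (simp add: V_simps B F_simps)
    also have "\<dots> = (g + ?d)\<^sup>2 + (g + ?d)" unfolding g by (simp add: F_simps)
    finally show ?thesis by blast
  qed
  moreover have "presents (fst U) v ?x ?x1"
    by (rule presents_mono[of _ _ x x1]; (intro span3_closed span3_base)?) (use assms in \<open>simp add: adapted_def\<close>)
  moreover have "presents (snd U) v ?p ?p1"
    by (rule presents_mono[of _ _ p p1]; (intro span3_closed span3_base)?) (use assms in \<open>simp add: adapted_def\<close>)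
  moreover have "q v \<noteq> 0" using assms by (simp add: adapted_def)
  ultimately have "adapted U v t ?x ?x1 ?p ?p1" unfolding adapted_def by blast
  then show ?thesis by (simp only: e_def e1_def h_def h1_def)
qed

end

subsection \<open>Edges in terms of frames\<close>

lemma is_vertex_cong:
  fixes a' b' c' d' :: "'a::field"
  assumes "is_vertex A U" "alg_iso (fst U) (quat a b)" "alg_iso (snd U) (quat c d)"
    "alg_iso (alg_tensor (quat a b) (quat c d)) (alg_tensor (quat a' b') (quat c' d'))" "b' \<noteq> 0" "d' \<noteq> 0"
  shows "is_vertex A (quat a' b', quat c' d')"
proof -
  have "alg_iso A (alg_tensor (fst U) (snd U))" using assms(1) by (simp add: is_vertex_def)
  then have "alg_iso A (alg_tensor (quat a' b') (quat c' d'))"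
    by (meson alg_iso_trans alg_iso_tensor assms(2-4))
  moreover have "is_quaternion (quat e f)" if "f \<noteq> 0" for e f :: 'a
    unfolding is_quaternion_def using that alg_iso_refl[of "quat e f"] by blast
  ultimately show ?thesis using assms(5,6) by (simp add: is_vertex_def)
qed

lemma edgeI_same_vertex: "edgeI V W \<Longrightarrow> same_vertex W' W \<Longrightarrow> edgeI W' V"
  unfolding edgeI_def edgeI_dir_def same_vertex_def by (meson alg_iso_trans)

context quad_space
begin

text \<open>Replacing x1 by x1 + (g / q x) x adds g^2 + g to q x * q x1, which cancels the Arf
  discrepancy and makes a + c exactly q v * q w. The clause on \<open>presents\<close> keeps the
  adjusted a available for another base vector y, as a type II move needs.\<close>

lemma adapted_presentation:
  assumes adapted: "adapted U v w x x1 p p1" and nz: "q x \<noteq> 0" "q p \<noteq> 0"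
  obtains a c where "alg_iso (fst U) (quat a (q v * q x))" "alg_iso (snd U) (quat c (q v * q p))"
    "a + c = q v * q w" "\<And>Q y. alg_iso Q (quat a (q y * q x)) \<Longrightarrow> q y \<noteq> 0 \<Longrightarrow> B y x = 0 \<Longrightarrow> B y x1 = 0 \<Longrightarrow> presents Q y x x1"
    "c = q p * q p1"
proof -
  from adapted have f: "frame v w x x1 p p1" by (simp add: adapted_def)
  note B = frameD[OF f]
  obtain g where g: "q v * q w + q x * q x1 + q p * q p1 = g\<^sup>2 + g" using adapted by (auto simp: adapted_def)
  define y1 where "y1 = x1 + scl (g / q x) x"
  have By: "B x y1 = 1" by (simp add: y1_def V_simps B)
  have y1: "y1 \<in> span3 z x x1" for z unfolding y1_def by (intro span3_closed span3_base)
  have x1: "x1 \<in> span3 z x y1" for z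
  proof -
    have "y1 + scl (g / q x) x \<in> span3 z x y1" by (intro span3_closed span3_base)
    then show ?thesis by (simp add: y1_def V_simps)
  qed
  have qy: "q x * q y1 = q x * q x1 + g\<^sup>2 + g"
    using nz by (simp add: y1_def V_simps B distrib_left power2_eq_square)
  show ?thesis
  proof (rule that[of "q x * q y1" "q p * q p1"])
    show "alg_iso (fst U) (quat (q x * q y1) (q v * q x))"
      using adapted y1 By nz span3_base by (intro presentsD[of "fst U" v x x1]) (auto simp: adapted_def)
    show "alg_iso (snd U) (quat (q p * q p1) (q v * q p))"
      using adapted nz span3_base B by (intro presentsD[of "snd U" v p p1]) (auto simp: adapted_def)
    have "q x * q y1 + q p * q p1 = q v * q w + (q v * q w + q x * q x1 + q p * q p1) + (g\<^sup>2 + g)"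
      by (simp add: qy F2 add_ac)
    then show "q x * q y1 + q p * q p1 = q v * q w" unfolding g by (simp add: F2 add_ac)
    show "presents Q y x x1" if Q: "alg_iso Q (quat (q x * q y1) (q y * q x))" and y: "q y \<noteq> 0" "B y x = 0" "B y x1 = 0" for Q y
    proof -
      have "B y y1 = 0" by (simp add: y1_def V_simps y)
      then have "presents Q y x y1" using Q y By nz by (intro presentsI) auto
      then show ?thesis using span3_base(2) x1 by (rule presents_mono)
    qed
  qed simp
qed

lemma presents_square:
  assumes "Q = quat (q p * q p1) (q v * q p * e\<^sup>2)" "B p p1 = 1" "B v p = 0" "B v p1 = 0"
    "q v \<noteq> 0" "q p \<noteq> 0" "e \<noteq> 0"
  shows "presents Q v p p1"
  unfolding assms(1) using assms(2-) by (intro presentsI alg_iso_quat_square[OF two]) auto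

text \<open>As a + c = q v * q w, the new algebras are [q v * q w, q x * q v) and, up to the square
  of q v, [q p' * q p1', q x * q p'). These are read off the frame with the planes (v, w) and (x,
  x1) exchanged.\<close>

lemma adapted_typeI:
  assumes "adapted U v w x x1 p p1" and nz: "q x \<noteq> 0"
  obtains W p' p1' where "edgeI U W" "\<And>A. is_vertex A U \<Longrightarrow> is_vertex A W" "adapted W x x1 v w p' p1'"
proof -
  obtain p' p1' where adapted: "adapted U v w x x1 p' p1'" and p: "q p' \<noteq> 0"
    using adapted_anisotropic[OF assms(1)] by metis
  have v: "q v \<noteq> 0" and f: "frame v w x x1 p' p1'" using adapted by (auto simp: adapted_def)
  note B = frameD[OF f]
  obtain a c where 1: "alg_iso (fst U) (quat a (q v * q x))" and 2: "alg_iso (snd U) (quat c (q v * q p'))"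
    and ac: "a + c = q v * q w" and c: "c = q p' * q p1'"
    using adapted_presentation[OF adapted nz p] by metis
  define W where "W = (quat (a + c) (q v * q x), quat c (q v * q x * (q v * q p')))"
  have nz': "q v * q x \<noteq> 0" "q v * q p' \<noteq> 0" using v nz p by auto
  have "edgeI_dir U W"
    unfolding edgeI_dir_def W_def fst_conv snd_conv
    using 1 2 nz' alg_iso_refl by blast
  then have "edgeI U W" by (simp add: edgeI_def)
  moreover have "is_vertex A W" if "is_vertex A U" for A
    unfolding W_def
    by (rule is_vertex_cong[OF that 1 2 alg_iso_tensor_typeI[OF two nz']]) (use nz' in auto)
  moreover have "adapted W x x1 v w p' p1'"
    unfolding adapted_def
  proof (intro conjI)
    show "frame x x1 v w p' p1'"
      using f unfolding frame_def expand_def by (simp add: B add_ac)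
    show "\<exists>e. q x * q x1 + q v * q w + q p' * q p1' = e\<^sup>2 + e"
      using adapted unfolding adapted_def by (simp add: add_ac)
    show "presents (fst W) x v w"
      by (rule presentsI) (use v nz B in \<open>auto simp: W_def ac mult.commute alg_iso_refl\<close>)
    show "presents (snd W) x p' p1'"
      by (rule presents_square[of _ _ _ _ "q v"])
        (use v nz p B in \<open>auto simp: W_def c power2_eq_square mult_ac\<close>)
  qed (rule nz)
  ultimately show ?thesis using that by blast
qed

text \<open>Here q v * q x * (a + c) = q w * q x * (q v)^2, and likewise for p', so up to squares w
  takes the place of v in the second slots.\<close>

lemma adapted_typeII:
  assumes "adapted U v w x x1 p p1" and nz: "q x \<noteq> 0" "q w \<noteq> 0"
  obtains W p' p1' where "edgeII U W" "\<And>A. is_vertex A U \<Longrightarrow> is_vertex A W" "adapted W w v x x1 p' p1'"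
proof -
  obtain p' p1' where adapted: "adapted U v w x x1 p' p1'" and p: "q p' \<noteq> 0"
    using adapted_anisotropic[OF assms(1)] by metis
  have v: "q v \<noteq> 0" and f: "frame v w x x1 p' p1'" using adapted by (auto simp: adapted_def)
  note B = frameD[OF f]
  obtain a c where 1: "alg_iso (fst U) (quat a (q v * q x))" and 2: "alg_iso (snd U) (quat c (q v * q p'))"
    and ac: "a + c = q v * q w" and c: "c = q p' * q p1'"
    and presents: "\<And>Q y. alg_iso Q (quat a (q y * q x)) \<Longrightarrow> q y \<noteq> 0 \<Longrightarrow> B y x = 0 \<Longrightarrow> B y x1 = 0 \<Longrightarrow> presents Q y x x1"
    using adapted_presentation[OF adapted nz(1) p] by metis
  define W where "W = (quat a (q v * q x * (a + c)), quat c (q v * q p' * (a + c)))"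
  have nz': "q v * q x \<noteq> 0" "q v * q p' \<noteq> 0" "a + c \<noteq> 0" using v nz p ac by auto
  have "edgeII_dir U W"
    unfolding edgeII_dir_def W_def fst_conv snd_conv
    using 1 2 nz' alg_iso_refl by blast
  then have "edgeII U W" by (simp add: edgeII_def)
  moreover have "is_vertex A W" if "is_vertex A U" for A
    unfolding W_def
    by (rule is_vertex_cong[OF that 1 2 alg_iso_tensor_typeII[OF two nz']]) (use nz' in auto)
  moreover have "adapted W w v x x1 p' p1'"
    unfolding adapted_def
  proof (intro conjI)
    show "frame w v x x1 p' p1'"
      using f unfolding frame_def expand_def by (simp add: B add_ac)
    show "\<exists>e. q w * q v + q x * q x1 + q p' * q p1' = e\<^sup>2 + e"
      using adapted unfolding adapted_def by (simp add: mult_ac)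
    have "q v * q x * (a + c) = q w * q x * (q v)\<^sup>2" by (simp add: ac power2_eq_square mult_ac)
    then have "fst W = quat a (q w * q x * (q v)\<^sup>2)" by (simp only: W_def fst_conv)
    then have "alg_iso (fst W) (quat a (q w * q x))"
      using alg_iso_quat_square[OF two, of "q w * q x" "q v" a] v nz by simp
    then show "presents (fst W) w x x1" by (rule presents) (use nz B in auto)
    show "presents (snd W) w p' p1'"
      by (rule presents_square[of _ _ _ _ "q v"])
        (use v nz p B ac in \<open>auto simp: W_def c power2_eq_square mult_ac\<close>)
  qed (rule nz)
  ultimately show ?thesis using that by blast
qed

text \<open>The first algebra is read off the pair v, t in both cases. The second depends only on y
  and the common orthogonal space of y, x, v, t, in which both remaining pairs lie.\<close>

lemma adapted_same_vertex:
  assumes U: "adapted U y x v t m m1" and V: "adapted V y x t v r r1" and v: "q v \<noteq> 0"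
  shows "same_vertex U V"
proof -
  have f: "frame y x v t m m1" using U by (simp add: adapted_def)
  have "alg_iso (fst U) (quat (q v * q t) (q y * q v))" "alg_iso (fst V) (quat (q v * q t) (q y * q v))"
    using U V v frameD(2)[OF f] span3_base by (auto simp: adapted_def intro!: presentsD)
  moreover
  obtain n n1 where n: "adapted V y x t v n n1" "q n \<noteq> 0" using adapted_anisotropic[OF V] by metis
  then have g: "frame y x t v n n1" by (simp add: adapted_def)
  have "z \<in> span3 y m m1" if "B z y = 0" "B z x = 0" "B z v = 0" "B z t = 0" for z
  proof -
    have "z = scl 0 y + scl (B z m1) m + scl (B z m) m1"
      using frame_expand[OF f, of z] that by (simp add: expand_def V_simps)
    then show ?thesis unfolding span3_def by blast
  qed
  then have "n \<in> span3 y m m1" "n1 \<in> span3 y m m1" using frameD[OF g] by auto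
  then have "alg_iso (snd U) (quat (q n * q n1) (q y * q n))"
    using U n frameD(3)[OF g] by (intro presentsD[of _ _ m m1]) (auto simp: adapted_def)
  moreover have "alg_iso (snd V) (quat (q n * q n1) (q y * q n))"
    using n frameD(3)[OF g] span3_base by (intro presentsD[of _ _ n n1]) (auto simp: adapted_def)
  ultimately show ?thesis unfolding same_vertex_def using alg_iso_sym alg_iso_trans by blast
qed

lemma path_of_frames:
  assumes U: "adapted U v t x x1 p p1" and V: "adapted V t v y y1 r r1"
    and nz: "q x \<noteq> 0" "q y \<noteq> 0" and xy: "B x y = 1"
    and vert: "is_vertex A U" "is_vertex A V"
  shows "\<exists>W1 W2. is_vertex A W1 \<and> is_vertex A W2 \<and> edgeI U W1 \<and> edgeII W1 W2 \<and> edgeI W2 V"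
proof -
  have fU: "frame v t x x1 p p1" and fV: "frame t v y y1 r r1" and v: "q v \<noteq> 0"
    using U V by (auto simp: adapted_def)
  note B = frameD[OF fU] frameD[OF fV]
  obtain W1 p' p1' where W1: "edgeI U W1" "is_vertex A W1" "adapted W1 x x1 v t p' p1'"
    using adapted_typeI[OF U nz(1)] vert by metis
  \<comment> \<open>Both v and t are orthogonal to y, so shearing x1 into y leaves them
    unchanged.\<close>
  obtain m m1 where "adapted W1 x y v t m m1"
    using adapted_shear[OF W1(3) xy] by (simp add: B V_simps)
  then obtain W2 m' m1' where W2: "edgeII W1 W2" "is_vertex A W2" "adapted W2 y x v t m' m1'"
    using adapted_typeII[OF _ v nz(2)] W1(2) by metis
  \<comment> \<open>The last edge is built from the far end: a type I move from V also reaches base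
    vector y, with the same four vectors, hence the vertex W2.\<close>
  obtain W p'' p1'' where W: "edgeI V W" "adapted W y y1 t v p'' p1''"
    using adapted_typeI[OF V nz(2)] by metis
  have "B y x = 1" using xy by (simp add: B_sym)
  then obtain n n1 where "adapted W y x t v n n1"
    using adapted_shear[OF W(2), of x] by (simp add: B V_simps)
  then have "same_vertex W2 W" using adapted_same_vertex[OF W2(3) _ v] by blast
  then have "edgeI W2 V" by (rule edgeI_same_vertex[OF W(1)])
  with W1 W2 show ?thesis by blast
qed

end

subsection \<open>Similitudes and general position\<close>

context quad_space
begin

text \<open>A similitude scales B by m, so one vector of each hyperbolic pair is divided by m.
  Products over a pair then keep their values, while second slots change by the square m^2.\<close>

lemma adapted_transport:
  assumes "quad_space scl q' B'"
    and bij: "bij g" and g_add: "\<And>x y. g (x + y) = g x + g y" and g_scl: "\<And>e x. g (scl e x) = scl e (g x)"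
    and m: "m \<noteq> 0" and qg: "\<And>x. q (g x) = m * q' x"
    and adapted': "quad_space.adapted scl q' B' U v w x x1 p p1"
  shows "adapted U (g v) (scl (1 / m) (g w)) (g x) (scl (1 / m) (g x1)) (g p) (scl (1 / m) (g p1))"
proof -
  interpret S: quad_space scl q' B' by fact
  have Bg: "B (g y) (g z) = m * B' y z" for y z
  proof -
    have "q (g y) + q (g z) + B (g y) (g z) = q (g y) + q (g z) + m * B' y z"
      using qg[of "y + z"] unfolding g_add q_add S.q_add by (simp add: qg distrib_left)
    then show ?thesis by simp
  qed
  have f: "S.frame v w x x1 p p1" using adapted' by (simp add: S.adapted_def)
  have "frame (g v) (scl (1 / m) (g w)) (g x) (scl (1 / m) (g x1)) (g p) (scl (1 / m) (g p1))"
    unfolding frame_def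
  proof (intro conjI allI)
    fix z
    obtain y where z: "z = g y" using bij bij_is_surj by (metis surj_def)
    have "expand (g v) (scl (1 / m) (g w)) (g x) (scl (1 / m) (g x1)) (g p) (scl (1 / m) (g p1)) (g y)
        = g (S.expand v w x x1 p p1 y)"
      using m by (simp add: expand_def S.expand_def g_add g_scl Bg B_scl_right scl_scl)
    then show "expand (g v) (scl (1 / m) (g w)) (g x) (scl (1 / m) (g x1)) (g p) (scl (1 / m) (g p1)) z = z"
      by (simp only: z S.frame_expand[OF f])
  qed (use m in \<open>simp_all add: B_scl_left B_scl_right Bg S.frameD[OF f]\<close>)
  moreover have "q (g v) \<noteq> 0" using adapted' m by (simp add: S.adapted_def qg)
  moreover have "q (g y) * q (scl (1 / m) (g z)) = q' y * q' z" for y z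
    using m by (simp add: q_scl qg power2_eq_square)
  moreover have "presents Q (g v) (g y) (scl (1 / m) (g y1))" if r: "S.presents Q v y y1" and v: "q' v \<noteq> 0" for Q y y1
    unfolding presents_def
  proof (intro ballI impI)
    fix z z1 assume z: "z \<in> span3 (g v) (g y) (scl (1 / m) (g y1))"
      "z1 \<in> span3 (g v) (g y) (scl (1 / m) (g y1))" "B z z1 = 1" "q z \<noteq> 0"
    have lift: "\<exists>u\<in>S.span3 v y y1. z = g u" if "z \<in> span3 (g v) (g y) (scl (1 / m) (g y1))" for z
    proof -
      from that obtain e f h where "z = scl e (g v) + scl f (g y) + scl h (scl (1 / m) (g y1))"
        unfolding span3_def by blast
      then have "z = g (scl e v + scl f y + scl (h / m) y1)" by (simp add: g_add g_scl scl_scl)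
      then show ?thesis unfolding S.span3_def by blast
    qed
    obtain u u1 where u: "u \<in> S.span3 v y y1" "z = g u" "u1 \<in> S.span3 v y y1" "z1 = g u1"
      using lift[OF z(1)] lift[OF z(2)] by blast
    have nz: "q' u \<noteq> 0" using z(4) by (auto simp: u qg)
    have "alg_iso Q (quat (q' u * q' (scl m u1)) (q' v * q' u))"
    proof (rule S.presentsD[OF r u(1) _ _ nz])
      show "scl m u1 \<in> S.span3 v y y1" using u(3) by (rule S.span3_scl)
      show "B' u (scl m u1) = 1" using z(3) by (simp add: u Bg S.B_scl_right)
    qed
    moreover have "alg_iso (quat (q' u * q' (scl m u1)) (q' v * q' u))
        (quat (q' u * q' (scl m u1)) (q' v * q' u * m\<^sup>2))"
      by (rule alg_iso_sym, rule alg_iso_quat_square[OF two]) (use v nz m in auto)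
    moreover have "q' u * q' (scl m u1) = q z * q z1" "q' v * q' u * m\<^sup>2 = q (g v) * q z"
      by (simp_all add: u qg S.q_scl power2_eq_square mult_ac)
    ultimately show "alg_iso Q (quat (q z * q z1) (q (g v) * q z))"
      using alg_iso_trans by metis
  qed
  ultimately show ?thesis using adapted' unfolding adapted_def S.adapted_def by simp
qed

definition reflection :: "'v \<Rightarrow> 'v \<Rightarrow> 'v" where
  "reflection z y = y + scl (B y z / q z) z"

text \<open>An isometry moves the frame and keeps the vertex. This is the freedom that makes general
  position reachable.\<close>

lemma adapted_reflection:
  assumes "adapted U v w x x1 p p1" and z: "q z \<noteq> 0"
  shows "adapted U (reflection z v) (reflection z w) (reflection z x) (reflection z x1) (reflection z p) (reflection z p1)"
proof -
  have "reflection z (reflection z y) = y" for y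
    using z by (simp add: reflection_def V_simps)
  then have bij: "bij (reflection z)" by (rule involuntory_imp_bij)
  have add: "reflection z (x + y) = reflection z x + reflection z y" and scl: "reflection z (scl e x) = scl e (reflection z x)" for e x y
    by (simp_all add: reflection_def V_simps add_divide_distrib)
  have q_refl: "q (reflection z y) = 1 * q y" for y
    using z by (simp add: reflection_def V_simps power2_eq_square)
  from adapted_transport[OF quad_space_axioms bij add scl one_neq_zero q_refl assms(1)]
  show ?thesis by (simp add: scl_one)
qed

section \<open>General position over fields with more than two elements\<close>

lemma avoid:
  assumes "(s::'a) \<noteq> 0" "s \<noteq> 1"
  obtains e where "e \<notin> {e1, e2, e3 :: 'a}"
proof -
  have "s + 1 \<noteq> 0" "s + 1 \<noteq> 1" "s + 1 \<noteq> s" using assms by (auto simp: F_eq)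
  then have "card {0, 1, s, s + 1} = 4" using assms by auto
  moreover have "card {e1, e2, e3} \<le> 3" by (simp add: card_insert_if)
  ultimately have "\<not> {0, 1, s, s + 1} \<subseteq> {e1, e2, e3}"
    using card_mono[of "{e1, e2, e3}" "{0, 1, s, s + 1}"] by auto
  then show ?thesis using that by blast
qed

text \<open>One of z1, z2, z1 + z2 pairs nontrivially with both x and y. Adding a multiple of x
  makes it anisotropic and leaves both pairings alone, as B x x = B x y = 0. The last conclusion
  holds since z is a combination of z1, z2 and x; it shows which vectors the reflection
  fixes.\<close>

lemma exists_reflection_vector:
  assumes s: "(s::'a) \<noteq> 0" "s \<noteq> 1" and xy: "B x y = 0" and z: "B z1 x \<noteq> 0" "B z2 y \<noteq> 0"
  obtains z where "q z \<noteq> 0" "B z x \<noteq> 0" "B z y \<noteq> 0"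
    "\<And>u. B z1 u = 0 \<Longrightarrow> B z2 u = 0 \<Longrightarrow> B x u = 0 \<Longrightarrow> B z u = 0"
proof -
  have "\<exists>z0\<in>{z1, z2, z1 + z2}. B z0 x \<noteq> 0 \<and> B z0 y \<noteq> 0"
    using z by (cases "B z1 y = 0"; cases "B z2 x = 0") (auto simp: B_add_left)
  then obtain z0 where z0: "z0 \<in> {z1, z2, z1 + z2}" "B z0 x \<noteq> 0" "B z0 y \<noteq> 0" by blast
  have perp: "B (z0 + scl e x) u = 0" if "B z1 u = 0" "B z2 u = 0" "B x u = 0" for e u
    using z0(1) that by (auto simp: B_add_left B_scl_left)
  have "\<exists>e. q (z0 + scl e x) \<noteq> 0"
  proof (cases "q z0 = 0")
    case True
    obtain e where e: "e \<notin> {0, B z0 x / q x, 0}" using avoid[OF s] .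
    have "q (z0 + scl e x) = e * (B z0 x + e * q x)"
      using True by (simp add: V_simps power2_eq_square distrib_left mult_ac)
    moreover have "B z0 x + e * q x \<noteq> 0"
      using e z0(2) by (cases "q x = 0") (auto simp: F_eq)
    ultimately show ?thesis using e by (intro exI[of _ e]) simp
  next
    case False
    then show ?thesis by (intro exI[of _ 0]) (simp add: V_simps)
  qed
  then obtain e where "q (z0 + scl e x) \<noteq> 0" by blast
  moreover have "B (z0 + scl e x) x \<noteq> 0" "B (z0 + scl e x) y \<noteq> 0"
    using z0 xy by (simp_all add: V_simps)
  ultimately show ?thesis using that perp by blast
qed

lemma adapted_anisotropic_avoiding:
  assumes s: "(s::'a) \<noteq> 0" "s \<noteq> 1" and U: "adapted U v w x x1 p p1" and xy: "B x y \<noteq> 0"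
  obtains x' x1' where "adapted U v w x' x1' p p1" "q x' \<noteq> 0" "B x' y \<noteq> 0"
proof (cases "q x = 0")
  case True
  have B: "B x x1 = 1" using U by (auto simp: adapted_def frame_def)
  \<comment> \<open>The values for which x + e x1 is isotropic or orthogonal to y. A quotient with
    denominator 0 is 0, and in that case the factor concerned is nonzero for every e.\<close>
  obtain e where e: "e \<notin> {0, 1 / q x1, B x y / B x1 y}" using avoid[OF s] .
  have "q (x + scl e x1) = e * (1 + e * q x1)"
    using True by (simp add: V_simps B power2_eq_square distrib_left)
  moreover have "1 + e * q x1 \<noteq> 0"
    using e by (cases "q x1 = 0") (auto simp: F_eq eq_divide_eq)
  moreover have "B (x + scl e x1) y \<noteq> 0"
    using e xy by (cases "B x1 y = 0") (auto simp: V_simps F_eq eq_divide_eq)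
  ultimately show ?thesis using that[OF adapted_add[OF U, of e]] e by auto
qed (use that U xy in blast)

lemma exists_path:
  assumes s: "(s::'a) \<noteq> 0" "s \<noteq> 1"
    and U: "adapted U v w x x1 p p1" and V: "adapted V t w' y y1 r r1"
    and vert: "is_vertex A U" "is_vertex A V"
  shows "\<exists>W1 W2. is_vertex A W1 \<and> is_vertex A W2 \<and> edgeI U W1 \<and> edgeII W1 W2 \<and> edgeI W2 V"
proof -
  \<comment> \<open>A reflection in z adds a nonzero multiple of z to t, which makes its pairing
    with v nonzero.\<close>
  have "\<exists>t w' y y1 r r1. adapted V t w' y y1 r r1 \<and> B v t \<noteq> 0"
  proof (cases "B v t = 0")
    case True
    have "B w v \<noteq> 0" "B w' t \<noteq> 0"
      using U V by (auto simp: adapted_def dest: frameD(16))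
    with True obtain z where z: "q z \<noteq> 0" "B z v \<noteq> 0" "B z t \<noteq> 0"
      using exists_reflection_vector[OF s] by metis
    then have "B v (reflection z t) \<noteq> 0"
      using True by (simp add: reflection_def V_simps B_sym[of _ z])
    then show ?thesis using adapted_reflection[OF V z(1)] by blast
  qed (use V in blast)
  then obtain t w' y y1 r r1 where V: "adapted V t w' y y1 r r1" and vt: "B v t \<noteq> 0" by blast
  define t' where "t' = scl (1 / B v t) t"
  have vt': "B v t' = 1" "B t' v = 1" using vt by (simp_all add: t'_def B_scl_right B_scl_left B_sym[of t])
  obtain w' where V: "adapted V t' w' y y1 r r1"
    unfolding t'_def using adapted_scale_base[OF V, of "1 / B v t"] vt by auto
  \<comment> \<open>After scaling, v and t' form a hyperbolic pair; shearing both frames makes it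
    common to them, in opposite order.\<close>
  obtain x x1 p p1 where U: "adapted U v t' x x1 p p1" using adapted_shear[OF U vt'(1)] by blast
  obtain y y1 r r1 where V: "adapted V t' v y y1 r r1" using adapted_shear[OF V vt'(2)] by blast
  note BU = frameD[of v t' x x1 p p1] and BV = frameD[of t' v y y1 r r1]
  have fU: "frame v t' x x1 p p1" and fV: "frame t' v y y1 r r1" using U V by (simp_all add: adapted_def)
  \<comment> \<open>This reflection must not disturb v and t': its vector is built from x1, y1 and
    x, all orthogonal to both.\<close>
  have "\<exists>x x1 y y1 r r1. adapted U v t' x x1 p p1 \<and> adapted V t' v y y1 r r1 \<and> B x y \<noteq> 0"
  proof (cases "B x y = 0 \<and> B x y1 = 0 \<and> B x1 y = 0 \<and> B x1 y1 = 0")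
    case True
    have "B x1 x \<noteq> 0" "B y1 y \<noteq> 0" using BU[OF fU] BV[OF fV] by simp_all
    with True obtain z where z: "q z \<noteq> 0" "B z x \<noteq> 0" "B z y \<noteq> 0"
      and perp: "\<And>u. B x1 u = 0 \<Longrightarrow> B y1 u = 0 \<Longrightarrow> B x u = 0 \<Longrightarrow> B z u = 0"
      using exists_reflection_vector[OF s] by metis
    have "B t' z = 0" "B v z = 0"
      using perp[of t'] perp[of v] BU[OF fU] BV[OF fV] by (simp_all add: B_sym[of _ z])
    then have fixed: "reflection z t' = t'" "reflection z v = v" by (simp_all add: reflection_def V_simps)
    have "B x (reflection z y) \<noteq> 0"
      using True z by (simp add: reflection_def V_simps B_sym[of _ z])
    then show ?thesis using U adapted_reflection[OF V z(1)] unfolding fixed by blast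
  next
    case False
    then show ?thesis using U V adapted_flip[OF U] adapted_flip[OF V] by blast
  qed
  then obtain x x1 y y1 r r1 where U: "adapted U v t' x x1 p p1" and V: "adapted V t' v y y1 r r1" and xy: "B x y \<noteq> 0"
    by blast
  obtain x x1 where U: "adapted U v t' x x1 p p1" "q x \<noteq> 0" and xy: "B y x \<noteq> 0"
    using adapted_anisotropic_avoiding[OF s U xy] by (metis B_sym)
  obtain y y1 where V: "adapted V t' v y y1 r r1" "q y \<noteq> 0" and xy: "B y x \<noteq> 0"
    using adapted_anisotropic_avoiding[OF s V xy] by metis
  define y' where "y' = scl (1 / B y x) y"
  have "adapted V t' v y' (scl (1 / (1 / B y x)) y1) r r1"
    unfolding y'_def using V xy by (intro adapted_scale) auto
  moreover have "B x y' = 1" "q y' \<noteq> 0"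
    using xy V(2) by (simp_all add: y'_def B_scl_right B_sym[of x] q_scl)
  ultimately show ?thesis using path_of_frames[OF U(1) _ U(2)] vert by blast
qed

end

section \<open>The Albert space as a quadratic space, and the conclusion\<close>

definition albert_polar :: "'a::field \<Rightarrow> 'a \<Rightarrow> 'a vec6 \<Rightarrow> 'a vec6 \<Rightarrow> 'a" where
  "albert_polar b d = (\<lambda>(x0, x1, x2, x3, x4, x5) (y0, y1, y2, y3, y4, y5).
     x0 * y1 + x1 * y0 + b * (x2 * y3 + x3 * y2) + d * (x4 * y5 + x5 * y4))"

lemma add_self_char_2: "(1::'a::field) + 1 = 0 \<Longrightarrow> (e::'a) + e = 0"
  by (metis distrib_right mult_1 mult_zero_left)

lemma quad_space_albert:
  assumes "(1::'a::field) + 1 = 0"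
  shows "quad_space scl6 (albert (a::'a) b c d) (albert_polar b d)"
proof
  have c2: "e + e = 0" for e :: 'a by (rule add_self_char_2[OF assms])
  have c2': "e + (e + f) = f" for e f :: 'a by (simp add: c2 flip: add.assoc)
  fix x y z :: "'a vec6" and e f :: 'a
  show "albert a b c d (x + y) = albert a b c d x + albert a b c d y + albert_polar b d x y"
    by (cases x; cases y) (simp add: albert_def albert_polar_def power2_eq_square algebra_simps c2 c2')
  show "albert a b c d (scl6 e x) = e\<^sup>2 * albert a b c d x"
    by (cases x) (simp add: albert_def scl6_def power2_eq_square algebra_simps)
  show "albert_polar b d (x + y) z = albert_polar b d x z + albert_polar b d y z"
    by (cases x; cases y; cases z) (simp add: albert_polar_def algebra_simps)
  show "albert_polar b d (scl6 e x) z = e * albert_polar b d x z"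
    by (cases x; cases z) (simp add: albert_polar_def scl6_def algebra_simps)
  show "scl6 e (x + y) = scl6 e x + scl6 e y"
    by (cases x; cases y) (simp add: scl6_def distrib_left)
  show "scl6 (e + f) x = scl6 e x + scl6 f x" "scl6 e (scl6 f x) = scl6 (e * f) x" "scl6 1 x = x"
    by (cases x; simp add: scl6_def distrib_right)+
  show "(1::'a) + 1 = 0" by fact
qed

text \<open>In the coordinates of \<open>emb\<close> the frame is 1, i + k, j, ij / b, l, kl / d.
  The three products are a + c, a and c, whose sum is 0.\<close>

lemma adapted_albert:
  fixes a b c d :: "'a::field"
  assumes 2: "(1::'a) + 1 = 0" and nz: "b \<noteq> 0" "d \<noteq> 0"
    and U: "alg_iso (fst U) (quat a b)" "alg_iso (snd U) (quat c d)"
  shows "quad_space.adapted scl6 (albert a b c d) (albert_polar b d) U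
    (1, 0, 0, 0, 0, 0) (0, 1, 0, 0, 0, 0) (0, 0, 1, 0, 0, 0) (0, 0, 0, 1 / b, 0, 0)
    (0, 0, 0, 0, 1, 0) (0, 0, 0, 0, 0, 1 / d)"
proof -
  interpret quad_space scl6 "albert a b c d" "albert_polar b d" by (rule quad_space_albert[OF 2])
  show ?thesis
    unfolding adapted_def
  proof (intro conjI)
    show "frame (1, 0, 0, 0, 0, 0) (0, 1, 0, 0, 0, 0) (0, 0, 1, 0, 0, 0) (0, 0, 0, 1 / b, 0, 0)
        (0, 0, 0, 0, 1, 0) (0, 0, 0, 0, 0, 1 / d)"
      unfolding frame_def expand_def using nz by (auto simp: albert_polar_def scl6_def)
    show "\<exists>e. albert a b c d (1, 0, 0, 0, 0, 0) * albert a b c d (0, 1, 0, 0, 0, 0)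
        + albert a b c d (0, 0, 1, 0, 0, 0) * albert a b c d (0, 0, 0, 1 / b, 0, 0)
        + albert a b c d (0, 0, 0, 0, 1, 0) * albert a b c d (0, 0, 0, 0, 0, 1 / d) = e\<^sup>2 + e"
      using nz by (intro exI[of _ 0]) (simp add: albert_def power2_eq_square F2 add_ac)
    show "presents (fst U) (1, 0, 0, 0, 0, 0) (0, 0, 1, 0, 0, 0) (0, 0, 0, 1 / b, 0, 0)"
      by (rule presentsI) (use nz U in \<open>simp_all add: albert_def albert_polar_def power2_eq_square\<close>)
    show "presents (snd U) (1, 0, 0, 0, 0, 0) (0, 0, 0, 0, 1, 0) (0, 0, 0, 0, 0, 1 / d)"
      by (rule presentsI) (use nz U in \<open>simp_all add: albert_def albert_polar_def power2_eq_square\<close>)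
  qed (simp add: albert_def)
qed

lemma same_vertex_field_2:
  fixes U V :: "'a::field alg \<times> 'a alg"
  assumes 2: "(1::'a) + 1 = 0" and F2: "\<And>s::'a. s = 0 \<or> s = 1"
    and "is_vertex A U" "is_vertex A V"
  shows "same_vertex U V"
proof -
  \<comment> \<open>Over two elements only [0,1) and [1,1) occur. Adding the radical vector of value
    1 to the second vector of the pair changes its value from 0 to 1.\<close>
  have "alg_iso (quat (1 * 1) (1 * 1)) (quat (1 * 0) (1 * 1 :: 'a))"
    by (rule alg_iso_ternary[OF 2, where x = 0 and y = 1 and z = 0 and x' = 1 and y' = 0 and z' = 1]) simp_all
  then have "alg_iso (quat a b) (quat 0 1)" if "b \<noteq> 0" for a b :: 'a
    using F2[of a] F2[of b] that by (auto simp: alg_iso_refl)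
  then have "alg_iso Q (quat 0 1)" if "is_quaternion Q" for Q :: "'a alg"
    using that alg_iso_trans unfolding is_quaternion_def by blast
  then show ?thesis
    using assms(3,4) alg_iso_sym alg_iso_trans unfolding is_vertex_def same_vertex_def by blast
qed

theorem theorem1:
  fixes A :: "'a::field alg"
  assumes "CHAR('a) = 2"
    and "\<exists>Q1 Q2. is_vertex A (Q1, Q2)"
  shows "\<forall>U V. is_vertex A U \<and> is_vertex A V \<longrightarrow>
           (\<exists>W1 W2. is_vertex A W1 \<and> is_vertex A W2 \<and>
              (same_vertex U W1 \<or> edgeI U W1) \<and>
              (same_vertex W1 W2 \<or> edgeII W1 W2) \<and>
              (same_vertex W2 V \<or> edgeI W2 V))"
proof (intro allI impI, elim conjE)
  fix U V assume U: "is_vertex A U" and V: "is_vertex A V"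
  have 2: "(1::'a) + 1 = 0" using of_nat_CHAR[where 'a = 'a] assms(1) by simp
  show "\<exists>W1 W2. is_vertex A W1 \<and> is_vertex A W2 \<and> (same_vertex U W1 \<or> edgeI U W1) \<and>
      (same_vertex W1 W2 \<or> edgeII W1 W2) \<and> (same_vertex W2 V \<or> edgeI W2 V)"
  proof (cases "\<forall>s::'a. s = 0 \<or> s = 1")
    case True
    then have "same_vertex U V" using same_vertex_field_2[OF 2 _ U V] by blast
    moreover have "same_vertex U U" by (simp add: same_vertex_def alg_iso_refl)
    ultimately show ?thesis using U by blast
  next
    case False
    then obtain s :: 'a where s: "s \<noteq> 0" "s \<noteq> 1" by blast
    obtain a b c d where U': "b \<noteq> 0" "d \<noteq> 0" "alg_iso (fst U) (quat a b)" "alg_iso (snd U) (quat c d)"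
      using U unfolding is_vertex_def is_quaternion_def by blast
    obtain a' b' c' d' where V': "b' \<noteq> 0" "d' \<noteq> 0" "alg_iso (fst V) (quat a' b')" "alg_iso (snd V) (quat c' d')"
      using V unfolding is_vertex_def is_quaternion_def by blast
    have "alg_iso A (alg_tensor (quat a b) (quat c d))" "alg_iso A (alg_tensor (quat a' b') (quat c' d'))"
      using U V alg_iso_trans alg_iso_tensor[OF U'(3,4)] alg_iso_tensor[OF V'(3,4)]
      unfolding is_vertex_def by blast+
    then have "alg_iso (alg_tensor (quat a' b') (quat c' d')) (alg_tensor (quat a b) (quat c d))"
      using alg_iso_sym alg_iso_trans by blast
    then obtain g r where g: "bij g" "\<And>x y. g (x + y) = g x + g y" "\<And>e x. g (scl6 e x) = scl6 e (g x)"
      "r \<noteq> 0" "\<And>x. albert a b c d (g x) = r * albert a' b' c' d' x"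
      by (rule albert_similar_of_alg_iso[OF 2 U'(1,2) V'(1,2)]) blast
    interpret quad_space scl6 "albert a b c d" "albert_polar b d" by (rule quad_space_albert[OF 2])
    \<comment> \<open>The frame of V is carried by the similitude into the Albert space of U, where
      both vertices can be compared.\<close>
    note adapted_V = adapted_transport[OF quad_space_albert[OF 2] g adapted_albert[OF 2 V']]
    show ?thesis using exists_path[OF s adapted_albert[OF 2 U'] adapted_V U V] by blast
  qed
qed

end
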